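(* Suppose that the Nodal Monitoring Policy described in the context is implemented for the network flow system. Let $\rho$ denote the resulting real-time density, and let $\rho^{(1)}$ and $\rho^{(2)}$ denote the density solutions obtained when the nodal injections are fixed at $q^{(1)}$ and $q^{(2)}$ respectively. Then $\rho_{ij}^{(2)}(t,x_{ij})\le\rho_{ij}(t,x_{ij})\le\rho_{ij}^{(1)}(t,x_{ij})$ for all $t\in[0,T]$, all $(i,j)\in\mathcal{E}$ and all $x_{ij}\in[0,L_{ij}]$.
   Context: Let $(\mathcal{V},\mathcal{E},\lambda)$ be a finite metric graph with directed edges, lengths $L_{ij}>0$, $I_{ij}=[0,L_{ij}]$, $\partial_+j=\{i:(i,j)\in\mathcal{E}\}$, $\partial_-j=\{k:(j,k)\in\mathcal{E}\}$. Densities $\rho_{ij}:[0,T]\times I_{ij}\to\mathbb{R}_+$, flows $\phi_{ij}:[0,T]\times I_{ij}\to\mathbb{R}$, nodal densities $\rho_i(t)$ and injections $q_i(t)$ satisfy $$\partial_t\rho_{ij}+\partial_x\phi_{ij}=0,\quad \phi_{ij}+f_{ij}(t,\rho_{ij},\partial_x\rho_{ij})=0,\quad q_j(t)+\sum_{i\in\partial_+j}\phi_{ij}(t,L_{ij})-\sum_{k\in\partial_-j}\phi_{jk}(t,0)=0,$$ $$\rho_{ij}(t,0)=\underline{\alpha}_{ij}(t)\rho_i(t),\qquad \rho_{ij}(t,L_{ij})=\overline{\alpha}_{ij}(t)\rho_j(t),$$ with initial conditions $\rho_{ij}(0,x)=\rho_{ij}^0(x)$, $\phi_{ij}(0,x)=\phi_{ij}^0(x)$,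 where $f_{ij}(t,u,v)$ is strictly increasing in $v$ and the positive control factors $\underline{\alpha}_{ij}(t),\overline{\alpha}_{ij}(t)$ are fixed and the same in all scenarios. Given bounds $q_i^{(1)}(t)\ge q_i^{(2)}(t)$ on $[0,T]$, the controls come from a feasible solution of the robust control problem, so that the densities $\rho^{(1)},\rho^{(2)}$ generated with these controls and injections $q^{(1)},q^{(2)}$ satisfy $\rho_{\min}\le\rho_{ij}^{(1)},\rho_{ij}^{(2)}\le\rho_{\max}$. Standing assumptions. Initial densities are ordered: $\rho^{(2)}_{ij}(0,x)\le\rho_{ij}(0,x)\le\rho^{(1)}_{ij}(0,x)$. The initial boundary value problems satisfy: (i) initial densities and flows are $C^2$ and consistent with the vertex conditions at $t=0$; (ii) compatibility functions $(t,\rho)\mapsto\underline{\alpha}_{ij}(t)\rho$, $\overline{\alpha}_{ij}(t)\rho$ and injections are $C^2$; (iii) there is a unique, twice continuously differentiable classical solution; (iv) stability: if $\rho_{ij,\epsilon},\phi_{ij,\epsilon}$ solve the system with the first equation replaced by $\partial_t\rho_{ij,\epsilon}+\partial_x\phi_{ij,\epsilon}-\epsilon=0$ and initial data $\rho_{ij}^0+\epsilon$, $\phi_{ij}^0$, then $\rho_{ij,\epsilon}\to\rho_{ij}$ pointwise as $\epsilon\to0$. If injections are reset at some times, these conditions are understood on each time interval between resets. Nodal Monitoring Policy (NMP). Let $\overline{\mathcal{S}}\subset\mathcal{V}$ be the set of nodes where the upper bound $q_i(t)\le q_i^{(1)}(t)$ is violated and $\underline{\mathcal{S}}\subset\mathcal{V}$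 the set of nodes where the lower bound $q_i(t)\ge q_i^{(2)}(t)$ is violated. Let $\rho_i^{(1)}(t),\rho_i^{(2)}(t)$ be the nodal densities obtained with injections fixed at $q^{(1)}$ and $q^{(2)}$. The real-time nodal densities $\rho_i(t)$ are monitored for $i\in\underline{\mathcal{S}}\cup\overline{\mathcal{S}}$. As long as no crossing occurs between $\rho_i$ and $\rho_i^{(1)}$ or $\rho_i^{(2)}$ at the monitored nodes, no action is taken. If a crossing of $\rho_i$ with $\rho_i^{(1)}$ is encountered at time $t_c$ at a node $i\in\overline{\mathcal{S}}$, the injection at $i$ is reset to $q_i^{(1)}(t)$ from time $t_c$ on, leaving the other injections unchanged; likewise, if a crossing of $\rho_i$ with $\rho_i^{(2)}$ is encountered at $i\in\underline{\mathcal{S}}$, the injection at $i$ is reset to $q_i^{(2)}(t)$. *)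

theory Defs
  imports "HOL-Analysis.Analysis"
begin

text \<open>Derivatives are taken within \<open>S\<close>, so they are one-sided at boundary points belonging to \<open>S\<close>.\<close>

definition C1_on :: "('a::real_normed_vector \<Rightarrow> 'b::real_normed_vector) \<Rightarrow> 'a set \<Rightarrow> bool" where
  "C1_on f S \<longleftrightarrow> (\<exists>f' :: 'a \<Rightarrow> 'a \<Rightarrow>\<^sub>L 'b.
     (\<forall>p\<in>S. (f has_derivative blinfun_apply (f' p)) (at p within S)) \<and> continuous_on S f')"

definition C2_on :: "('a::real_normed_vector \<Rightarrow> 'b::real_normed_vector) \<Rightarrow> 'a set \<Rightarrow> bool" where
  "C2_on f S \<longleftrightarrow> (\<exists>f' :: 'a \<Rightarrow> 'a \<Rightarrow>\<^sub>L 'b.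
     (\<forall>p\<in>S. (f has_derivative blinfun_apply (f' p)) (at p within S)) \<and> C1_on f' S)"

text \<open>
  \<open>diss N i j t u v\<close> is the dissipation function f of the edge \<open>(i, j)\<close>; \<open>alpha_lo\<close> and
  \<open>alpha_hi\<close> are the control factors at the start and at the end of the edge.
\<close>

record 'v network =
  verts :: "'v set"
  edges :: "('v \<times> 'v) set"
  len :: "'v \<Rightarrow> 'v \<Rightarrow> real"
  diss :: "'v \<Rightarrow> 'v \<Rightarrow> real \<Rightarrow> real \<Rightarrow> real \<Rightarrow> real"
  alpha_lo :: "'v \<Rightarrow> 'v \<Rightarrow> real \<Rightarrow> real"
  alpha_hi :: "'v \<Rightarrow> 'v \<Rightarrow> real \<Rightarrow> real"

definition flow_network :: "'v network \<Rightarrow> real \<Rightarrow> bool" where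
  "flow_network N T \<longleftrightarrow>
     finite (verts N) \<and> edges N \<subseteq> verts N \<times> verts N \<and>
     (\<forall>(i, j)\<in>edges N.
        len N i j > 0 \<and>
        (\<forall>t\<in>{0..T}. alpha_lo N i j t > 0 \<and> alpha_hi N i j t > 0) \<and>
        (\<forall>t\<in>{0..T}. \<forall>u\<ge>0. strict_mono (diss N i j t u)))"

definition in_nbrs :: "'v network \<Rightarrow> 'v \<Rightarrow> 'v set" where
  "in_nbrs N j = {i. (i, j) \<in> edges N}"

definition out_nbrs :: "'v network \<Rightarrow> 'v \<Rightarrow> 'v set" where
  "out_nbrs N j = {k. (j, k) \<in> edges N}"

text \<open>Edge densities and flows have arguments tail, head, time, position.\<close>

record 'v state =
  dens :: "'v \<Rightarrow> 'v \<Rightarrow> real \<Rightarrow> real \<Rightarrow> real"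
  flow :: "'v \<Rightarrow> 'v \<Rightarrow> real \<Rightarrow> real \<Rightarrow> real"
  nodal :: "'v \<Rightarrow> real \<Rightarrow> real"

definition d_time :: "real set \<Rightarrow> (real \<Rightarrow> real \<Rightarrow> real) \<Rightarrow> real \<Rightarrow> real \<Rightarrow> real" where
  "d_time J u t x = vector_derivative (\<lambda>s. u s x) (at t within J)"

definition d_space :: "real \<Rightarrow> (real \<Rightarrow> real \<Rightarrow> real) \<Rightarrow> real \<Rightarrow> real \<Rightarrow> real" where
  "d_space L u t x = vector_derivative (\<lambda>y. u t y) (at x within {0..L})"

definition vertex_balance ::
    "'v network \<Rightarrow> ('v \<Rightarrow> real \<Rightarrow> real) \<Rightarrow> 'v state \<Rightarrow> real \<Rightarrow> bool" where
  "vertex_balance N q s t \<longleftrightarrow> (\<forall>j\<in>verts N.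
     q j t + (\<Sum>i\<in>in_nbrs N j. flow s i j t (len N i j)) - (\<Sum>k\<in>out_nbrs N j. flow s j k t 0) = 0)"

definition vertex_density :: "'v network \<Rightarrow> 'v state \<Rightarrow> real \<Rightarrow> bool" where
  "vertex_density N s t \<longleftrightarrow> (\<forall>(i, j)\<in>edges N.
     dens s i j t 0 = alpha_lo N i j t * nodal s i t \<and>
     dens s i j t (len N i j) = alpha_hi N i j t * nodal s j t)"

text \<open>
  The equations, in the classical sense, at the times in \<open>J\<close>, with source term \<open>\<epsilon>\<close> in the
  continuity equation.
\<close>

definition satisfies_equations ::
    "'v network \<Rightarrow> real set \<Rightarrow> real \<Rightarrow> ('v \<Rightarrow> real \<Rightarrow> real) \<Rightarrow> 'v state \<Rightarrow> bool" where
  "satisfies_equations N J \<epsilon> q s \<longleftrightarrow>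
     (\<forall>(i, j)\<in>edges N.
        C2_on (\<lambda>(t, x). dens s i j t x) (J \<times> {0..len N i j}) \<and>
        C2_on (\<lambda>(t, x). flow s i j t x) (J \<times> {0..len N i j}) \<and>
        (\<forall>t\<in>J. \<forall>x\<in>{0..len N i j}.
           d_time J (dens s i j) t x + d_space (len N i j) (flow s i j) t x - \<epsilon> = 0 \<and>
           flow s i j t x
             + diss N i j t (dens s i j t x) (d_space (len N i j) (dens s i j) t x) = 0)) \<and>
     (\<forall>t\<in>J. vertex_balance N q s t)"

text \<open>
  Solution of the initial boundary value problem on \<open>{a..b}\<close> with initial data \<open>\<rho>0\<close>, \<open>\<phi>0\<close>.
  The set \<open>J\<close> of times at which the equations hold is \<open>{a..b}\<close> if the injections are
  compatible with the initial flows, and \<open>{a<..b}\<close> if the injections jump at time \<open>a\<close>: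
  then the flow is discontinuous at \<open>t = a\<close> at the vertices, and the initial flow is attained
  only in the interior of the edges. If \<open>a \<in> J\<close>, it is attained on the
  closed edge by continuity.
\<close>

definition ibvp_solution ::
    "'v network \<Rightarrow> real \<Rightarrow> real \<Rightarrow> real set \<Rightarrow> real \<Rightarrow> ('v \<Rightarrow> real \<Rightarrow> real) \<Rightarrow>
     ('v \<Rightarrow> 'v \<Rightarrow> real \<Rightarrow> real) \<Rightarrow> ('v \<Rightarrow> 'v \<Rightarrow> real \<Rightarrow> real) \<Rightarrow> 'v state \<Rightarrow> bool" where
  "ibvp_solution N a b J \<epsilon> q \<rho>0 \<phi>0 s \<longleftrightarrow>
     satisfies_equations N J \<epsilon> q s \<and>
     (\<forall>t\<in>{a..b}. vertex_density N s t) \<and>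
     (\<forall>(i, j)\<in>edges N.
        continuous_on ({a..b} \<times> {0..len N i j}) (\<lambda>(t, x). dens s i j t x) \<and>
        continuous_on ({a..b} \<times> {0<..<len N i j}) (\<lambda>(t, x). flow s i j t x) \<and>
        (\<forall>t\<in>{a..b}. \<forall>x\<in>{0..len N i j}. dens s i j t x \<ge> 0) \<and>
        (\<forall>x\<in>{0..len N i j}. dens s i j a x = \<rho>0 i j x) \<and>
        (\<forall>x\<in>{0<..<len N i j}. flow s i j a x = \<phi>0 i j x))"

definition smooth_data :: "'v network \<Rightarrow> real \<Rightarrow> 'v state \<Rightarrow> bool" where
  "smooth_data N a s \<longleftrightarrow> vertex_density N s a \<and>
     (\<forall>(i, j)\<in>edges N. C2_on (dens s i j a) {0..len N i j} \<and> C2_on (flow s i j a) {0..len N i j})"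

definition smooth_inputs ::
    "'v network \<Rightarrow> real \<Rightarrow> real \<Rightarrow> ('v \<Rightarrow> real \<Rightarrow> real) \<Rightarrow> bool" where
  "smooth_inputs N a b q \<longleftrightarrow>
     (\<forall>(i, j)\<in>edges N.
        C2_on (\<lambda>(t, r). alpha_lo N i j t * r) ({a..b} \<times> {0..}) \<and>
        C2_on (\<lambda>(t, r). alpha_hi N i j t * r) ({a..b} \<times> {0..})) \<and>
     (\<forall>j\<in>verts N. C2_on (q j) {a..b})"

definition unique_solution ::
    "'v network \<Rightarrow> real \<Rightarrow> real \<Rightarrow> real set \<Rightarrow> ('v \<Rightarrow> real \<Rightarrow> real) \<Rightarrow> 'v state \<Rightarrow> bool" where
  "unique_solution N a b J q s \<longleftrightarrow>
     ibvp_solution N a b J 0 q (\<lambda>i j. dens s i j a) (\<lambda>i j. flow s i j a) s \<and>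
     (\<forall>s' :: 'v state.
        ibvp_solution N a b J 0 q (\<lambda>i j. dens s i j a) (\<lambda>i j. flow s i j a) s' \<longrightarrow>
        (\<forall>(i, j)\<in>edges N. \<forall>x\<in>{0..len N i j}.
           (\<forall>t\<in>{a..b}. dens s' i j t x = dens s i j t x) \<and>
           (\<forall>t\<in>J. flow s' i j t x = flow s i j t x)))"

definition stable_solution ::
    "'v network \<Rightarrow> real \<Rightarrow> real \<Rightarrow> real set \<Rightarrow> ('v \<Rightarrow> real \<Rightarrow> real) \<Rightarrow> 'v state \<Rightarrow> bool" where
  "stable_solution N a b J q s \<longleftrightarrow>
     (\<forall>(\<epsilon> :: nat \<Rightarrow> real) (S :: nat \<Rightarrow> 'v state).
        \<epsilon> \<longlonglongrightarrow> 0 \<and> (\<forall>n. \<epsilon> n \<noteq> 0) \<and>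
        (\<forall>n. ibvp_solution N a b J (\<epsilon> n) q (\<lambda>i j x. dens s i j a x + \<epsilon> n) (\<lambda>i j. flow s i j a) (S n)) \<longrightarrow>
        (\<forall>(i, j)\<in>edges N. \<forall>t\<in>{a..b}. \<forall>x\<in>{0..len N i j}.
           (\<lambda>n. dens (S n) i j t x) \<longlonglongrightarrow> dens s i j t x))"

text \<open>The standing assumptions for the problem on \<open>{a..b}\<close> with the initial data taken from \<open>s\<close>.\<close>

definition well_posed ::
    "'v network \<Rightarrow> real \<Rightarrow> real \<Rightarrow> real set \<Rightarrow> ('v \<Rightarrow> real \<Rightarrow> real) \<Rightarrow> 'v state \<Rightarrow> bool" where
  "well_posed N a b J q s \<longleftrightarrow>
     smooth_data N a s \<and> (a \<in> J \<longrightarrow> vertex_balance N q s a) \<and>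
     smooth_inputs N a b q \<and>
     unique_solution N a b J q s \<and>
     stable_solution N a b J q s"

definition upper_violations ::
    "'v network \<Rightarrow> real \<Rightarrow> ('v \<Rightarrow> real \<Rightarrow> real) \<Rightarrow> ('v \<Rightarrow> real \<Rightarrow> real) \<Rightarrow> 'v set" where
  "upper_violations N T q q1 = {i \<in> verts N. \<exists>t\<in>{0..T}. \<not> q i t \<le> q1 i t}"

definition lower_violations ::
    "'v network \<Rightarrow> real \<Rightarrow> ('v \<Rightarrow> real \<Rightarrow> real) \<Rightarrow> ('v \<Rightarrow> real \<Rightarrow> real) \<Rightarrow> 'v set" where
  "lower_violations N T q q2 = {i \<in> verts N. \<exists>t\<in>{0..T}. \<not> q i t \<ge> q2 i t}"

text \<open>At time \<open>t\<close> the graph of \<open>g\<close> meets that of \<open>h\<close> and passes above it.\<close>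

definition crosses_above :: "(real \<Rightarrow> real) \<Rightarrow> (real \<Rightarrow> real) \<Rightarrow> real \<Rightarrow> real \<Rightarrow> bool" where
  "crosses_above g h T t \<longleftrightarrow> g t = h t \<and> (\<forall>\<delta>>0. \<exists>s\<in>{0..T}. t < s \<and> s < t + \<delta> \<and> g s > h s)"

datatype mode = Nominal | Upper | Lower

fun applied_injection ::
    "('v \<Rightarrow> real \<Rightarrow> real) \<Rightarrow> ('v \<Rightarrow> real \<Rightarrow> real) \<Rightarrow> ('v \<Rightarrow> real \<Rightarrow> real) \<Rightarrow>
     ('v \<Rightarrow> mode) \<Rightarrow> 'v \<Rightarrow> real \<Rightarrow> real" where
  "applied_injection q q1 q2 m i t =
     (case m i of Nominal \<Rightarrow> q i t | Upper \<Rightarrow> q1 i t | Lower \<Rightarrow> q2 i t)"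

text \<open>
  The times \<open>0 = \<tau> 0 < \<tau> 1 < \<dots> < \<tau> n = T\<close> are the reset times together with the two end
  points; \<open>m k i\<close> says which injection is used at node \<open>i\<close> between \<open>\<tau> k\<close> and \<open>\<tau> (Suc k)\<close>.
  Before time 0 all modes are nominal, so that \<open>m 0\<close> accounts for resets at time 0.

  The word crossing is taken so as to cover every usual reading: a node may be reset only
  when the two nodal densities meet, and it must have been reset when they actually cross.
  A tangential contact allows a reset, but does not force it.
\<close>

definition monitoring_policy ::
    "'v network \<Rightarrow> real \<Rightarrow> ('v \<Rightarrow> real \<Rightarrow> real) \<Rightarrow> ('v \<Rightarrow> real \<Rightarrow> real) \<Rightarrow> ('v \<Rightarrow> real \<Rightarrow> real) \<Rightarrow>
     'v state \<Rightarrow> 'v state \<Rightarrow> 'v state \<Rightarrow> nat \<Rightarrow> (nat \<Rightarrow> real) \<Rightarrow> (nat \<Rightarrow> 'v \<Rightarrow> mode) \<Rightarrow> bool" where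
  "monitoring_policy N T q q1 q2 s s1 s2 n \<tau> m \<longleftrightarrow>
     \<tau> 0 = 0 \<and> \<tau> n = T \<and> (\<forall>k<n. \<tau> k < \<tau> (Suc k)) \<and>
     (\<forall>k. Suc k < n \<longrightarrow> (\<exists>i\<in>verts N. m (Suc k) i \<noteq> m k i)) \<and>
     (\<forall>k<n. \<forall>i\<in>verts N.
        m k i \<noteq> (if k = 0 then Nominal else m (k - 1) i) \<longrightarrow>
        (m k i = Upper \<and> i \<in> upper_violations N T q q1 \<and> nodal s i (\<tau> k) = nodal s1 i (\<tau> k)) \<or>
        (m k i = Lower \<and> i \<in> lower_violations N T q q2 \<and> nodal s i (\<tau> k) = nodal s2 i (\<tau> k))) \<and>
     (\<forall>k<n. \<forall>t\<in>{\<tau> k..<\<tau> (Suc k)}.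
        (\<forall>i\<in>upper_violations N T q q1.
           crosses_above (nodal s i) (nodal s1 i) T t \<longrightarrow> m k i = Upper) \<and>
        (\<forall>i\<in>lower_violations N T q q2.
           crosses_above (nodal s2 i) (nodal s i) T t \<longrightarrow> m k i = Lower))"

text \<open>
  The flow under the policy. After a reset the problem is started afresh from the state reached
  at the reset time; since an injection may jump there, the equations with the new
  injections hold on \<open>{\<tau> k<..\<tau> (Suc k)}\<close>.
\<close>

definition monitored_flow ::
    "'v network \<Rightarrow> real \<Rightarrow> ('v \<Rightarrow> real \<Rightarrow> real) \<Rightarrow> ('v \<Rightarrow> real \<Rightarrow> real) \<Rightarrow> ('v \<Rightarrow> real \<Rightarrow> real) \<Rightarrow>
     'v state \<Rightarrow> 'v state \<Rightarrow> 'v state \<Rightarrow> bool" where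
  "monitored_flow N T q q1 q2 s s1 s2 \<longleftrightarrow>
     (\<exists>n \<tau> m. monitoring_policy N T q q1 q2 s s1 s2 n \<tau> m \<and>
        (\<forall>k<n. well_posed N (\<tau> k) (\<tau> (Suc k))
           (if k = 0 \<and> (\<forall>i\<in>verts N. m 0 i = Nominal) then {\<tau> k..\<tau> (Suc k)}
            else {\<tau> k<..\<tau> (Suc k)})
           (applied_injection q q1 q2 (m k)) s))"

end

theory Submission
  imports Defs
begin

text \<open>
  The flow is an \<open>L\<^sup>1\<close> contraction. For two solutions put \<open>w = \<rho> - \<rho>'\<close> and \<open>\<Phi> = \<phi> - \<phi>'\<close>.
  At a boundary point of \<open>{w > 0}\<close> inside an edge the densities agree, so monotonicity of the
  dissipation in the slope makes \<open>\<Phi>\<close> nonpositive where \<open>w\<close> becomes positive and nonnegative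
  where it ceases to be. Hence \<open>\<integral> max 0 w\<close>, summed over the edges, grows at most by the
  boundary fluxes at those nodes where the nodal densities satisfy \<open>\<rho>\<^sub>j > \<rho>\<^sub>j'\<close>, and by the vertex
  balance these add up to \<open>q\<^sub>j - q\<^sub>j'\<close>. Under the policy, a nodal density above that of the upper
  scenario must have crossed it, so that the node has been reset, and from then on its injection is
  one of the two bounds. The perturbation argument based on the stability assumption is avoided:
  the perturbed problems need not have solutions, as their initial data may violate the vertex
  conditions.
\<close>

section \<open>Flux estimates on the positivity set in one variable\<close>

text \<open>Integrating \<open>\<Phi>'\<close> turns the pointwise bound into a flux difference. The
  bound is assumed only at interior points, because in the application the end points may be zeros
  of \<open>w\<close>; continuity of \<open>D\<close> and \<open>\<Phi>'\<close> carries it over to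
  them.\<close>

lemma integral_le_flux_drop:
  fixes \<Phi> \<Phi>' D :: "real \<Rightarrow> real"
  assumes cd: "c \<le> d"
    and \<Phi>: "\<And>x. x \<in> {c..d} \<Longrightarrow> (\<Phi> has_vector_derivative \<Phi>' x) (at x within {c..d})"
    and cont: "continuous_on {c..d} \<Phi>'" "continuous_on {c..d} D"
    and le: "\<And>x. x \<in> {c<..<d} \<Longrightarrow> D x \<le> \<epsilon> - \<Phi>' x"
  shows "integral {c..d} D \<le> \<epsilon> * (d - c) + \<Phi> c - \<Phi> d"
proof (cases "c = d")
  case False
  then have cl: "closure {c<..<d} = {c..d}" using cd by simp
  have "D x + \<Phi>' x \<le> \<epsilon>" if "x \<in> {c..d}" for x
  proof (rule continuous_le_on_closure[of "{c<..<d}" "\<lambda>x. D x + \<Phi>' x"])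
    show "continuous_on (closure {c<..<d}) (\<lambda>x. D x + \<Phi>' x)"
      unfolding cl by (intro continuous_intros cont)
    show "x \<in> closure {c<..<d}" using that cl by simp
    show "D x + \<Phi>' x \<le> \<epsilon>" if "x \<in> {c<..<d}" for x using le[OF that] by simp
  qed
  then have le': "D x \<le> \<epsilon> - \<Phi>' x" if "x \<in> {c..d}" for x using that by (simp add: algebra_simps)
  have "((\<lambda>x. \<epsilon> - \<Phi>' x) has_integral (\<epsilon> * (d - c) - (\<Phi> d - \<Phi> c))) {c..d}"
    using has_integral_diff[OF has_integral_const_real[of \<epsilon> c d]
        fundamental_theorem_of_calculus[OF cd \<Phi>]] cd by (simp add: mult.commute)
  then have "integral {c..d} D \<le> \<epsilon> * (d - c) - (\<Phi> d - \<Phi> c)"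
    using le' cont(2) by (intro has_integral_le[OF integrable_integral])
      (auto intro: integrable_continuous_real)
  then show ?thesis by simp
qed simp

text \<open>The nonpositive points in \<open>{y..d}\<close> form a nonempty compact set and so have
  a largest element. The case \<open>r = d\<close> is included; positivity to the right is then
  vacuous.\<close>

lemma last_nonpos:
  fixes w :: "real \<Rightarrow> real"
  assumes "continuous_on {c..d} w" "y \<in> {c..d}" "w y \<le> 0"
  obtains r where "r \<in> {y..d}" "w r \<le> 0" "\<And>x. x \<in> {r<..d} \<Longrightarrow> w x > 0"
proof -
  have "compact ({y..d} \<inter> w -` {..0})"
    unfolding compact_eq_bounded_closed using assms(2)
    by (auto intro!: bounded_Int continuous_closed_preimage continuous_on_subset[OF assms(1)])
  then obtain r where r: "r \<in> {y..d} \<inter> w -` {..0}" "\<forall>x\<in>{y..d} \<inter> w -` {..0}. x \<le> r"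
    using assms compact_attains_sup[of "{y..d} \<inter> w -` {..0}"] by force
  show ?thesis
  proof
    show "r \<in> {y..d}" "w r \<le> 0" using r by auto
    show "w x > 0" if "x \<in> {r<..d}" for x
      using r(1) r(2)[rule_format, of x] that by (cases "w x \<le> 0") auto
  qed
qed

lemma first_nonpos:
  fixes w :: "real \<Rightarrow> real"
  assumes "continuous_on {c..d} w" "y \<in> {c..d}" "w y \<le> 0"
  obtains p where "p \<in> {c..y}" "w p \<le> 0" "\<And>x. x \<in> {c..<p} \<Longrightarrow> w x > 0"
proof -
  have "continuous_on {-d..-c} (\<lambda>x. w (- x))"
    by (rule continuous_on_compose2[OF assms(1)]) (auto intro: continuous_intros)
  then obtain r where r: "r \<in> {-y..-c}" "w (-r) \<le> 0" "\<And>x. x \<in> {r<..-c} \<Longrightarrow> w (-x) > 0"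
    using last_nonpos[of "-d" "-c" "\<lambda>x. w (- x)" "-y"] assms by auto
  show ?thesis
  proof
    show "-r \<in> {c..y}" "w (-r) \<le> 0" using r by auto
    show "w x > 0" if "x \<in> {c..<-r}" for x using r(3)[of "-x"] that by auto
  qed
qed

text \<open>The limit from the positive side gives \<open>0 \<le> w z\<close>. Both sides are
  covered, so that either end of a stretch of positivity can be treated.\<close>

lemma zero_at_sign_change:
  fixes w :: "real \<Rightarrow> real"
  assumes "continuous_on {c..d} w" "z \<in> {c..d}" "w z \<le> 0"
    and "(z < d \<and> (\<forall>x\<in>{z<..d}. w x > 0)) \<or> (c < z \<and> (\<forall>x\<in>{c..<z}. w x > 0))"
  shows "w z = 0"
  using assms(4)
proof
  assume *: "z < d \<and> (\<forall>x\<in>{z<..d}. w x > 0)"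
  have "0 \<le> w z"
    by (rule continuous_ge_on_closure[of "{z<..<d}" w])
      (use * assms in \<open>auto intro: continuous_on_subset less_imp_le\<close>)
  then show ?thesis using assms(3) by simp
next
  assume *: "c < z \<and> (\<forall>x\<in>{c..<z}. w x > 0)"
  have "0 \<le> w z"
    by (rule continuous_ge_on_closure[of "{c<..<z}" w])
      (use * assms in \<open>auto intro: continuous_on_subset less_imp_le\<close>)
  then show ?thesis using assms(3) by simp
qed

text \<open>
  A stretch of positivity of \<open>w\<close> between two zeros carries \<open>\<Phi>\<close> from a nonpositive to a nonnegative
  value, so \<open>\<Phi>'\<close> is nonnegative somewhere on it. On intervals so short that \<open>\<Phi>'\<close> oscillates by
  less than \<open>\<epsilon>\<close>, this bounds \<open>D\<close> by \<open>2 * \<epsilon>\<close> pointwise between the first and the last zero; no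
  decomposition of \<open>{w > 0}\<close> into its possibly infinitely many components is needed.
\<close>

lemma integral_le_boundary_flux:
  fixes w \<Phi> \<Phi>' D :: "real \<Rightarrow> real"
  assumes ab: "a \<le> b" and "\<epsilon> > 0"
    and w: "continuous_on {a..b} w"
    and \<Phi>: "\<And>x. x \<in> {a..b} \<Longrightarrow> (\<Phi> has_vector_derivative \<Phi>' x) (at x within {a..b})"
    and \<Phi>': "continuous_on {a..b} \<Phi>'" and D: "continuous_on {a..b} D"
    and nonpos: "\<And>x. x \<in> {a..b} \<Longrightarrow> w x \<le> 0 \<Longrightarrow> D x \<le> 0"
    and pos: "\<And>x. x \<in> {a..b} \<Longrightarrow> w x > 0 \<Longrightarrow> D x \<le> \<epsilon> - \<Phi>' x"
    and up: "\<And>z y. \<lbrakk>z \<in> {a..b}; y \<in> {a..b}; z < y; w z = 0; \<forall>x\<in>{z<..y}. w x > 0\<rbrakk> \<Longrightarrow> \<Phi> z \<le> 0"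
    and down: "\<And>z y. \<lbrakk>z \<in> {a..b}; y \<in> {a..b}; y < z; w z = 0; \<forall>x\<in>{y..<z}. w x > 0\<rbrakk> \<Longrightarrow> \<Phi> z \<ge> 0"
  shows "integral {a..b} D \<le> 2 * \<epsilon> * (b - a) +
    (if w a > 0 then \<Phi> a else 0) - (if w b > 0 then \<Phi> b else 0)"
proof -
  define F where "F x = (if w x > 0 then \<Phi> x else 0)" for x
  \<comment> \<open>The terms in \<open>F\<close> telescope, so \<open>P\<close> passes from
    adjacent intervals to their union, and Bolzano's bisection principle reduces the claim to short
    intervals. These may reach beyond \<open>{a..b}\<close>, whence the premise inside
    \<open>P\<close>.\<close>
  define P where "P c d \<longleftrightarrow> a \<le> c \<and> d \<le> b \<longrightarrow> integral {c..d} D \<le> 2 * \<epsilon> * (d - c) + F c - F d" for c d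
  have int: "D integrable_on {c..d}" if "a \<le> c" "d \<le> b" for c d
    using that by (intro integrable_continuous_real continuous_on_subset[OF D]) auto
  have drop: "integral {c..d} D \<le> \<epsilon> * (d - c) + \<Phi> c - \<Phi> d"
    if cd: "a \<le> c" "c \<le> d" "d \<le> b" "\<And>x. x \<in> {c<..<d} \<Longrightarrow> w x > 0" for c d
  proof (rule integral_le_flux_drop)
    have sub: "{c..d} \<subseteq> {a..b}" using cd by auto
    show "(\<Phi> has_vector_derivative \<Phi>' x) (at x within {c..d})" if "x \<in> {c..d}" for x
      using has_vector_derivative_within_subset[OF \<Phi> sub] that sub by auto
    show "continuous_on {c..d} \<Phi>'" "continuous_on {c..d} D"
      using continuous_on_subset \<Phi>' D sub by blast+
    show "D x \<le> \<epsilon> - \<Phi>' x" if "x \<in> {c<..<d}" for x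
      using that cd by (intro pos) auto
  qed (use cd in auto)
  obtain \<delta> where \<delta>: "\<delta> > 0" "\<And>x y. \<lbrakk>x \<in> {a..b}; y \<in> {a..b}; \<bar>x - y\<bar> < \<delta>\<rbrakk> \<Longrightarrow> \<bar>\<Phi>' x - \<Phi>' y\<bar> < \<epsilon>"
    using compact_uniformly_continuous[OF \<Phi>' compact_Icc] \<open>\<epsilon> > 0\<close>
    unfolding uniformly_continuous_on_def dist_real_def by metis
  have between: "D y \<le> 2 * \<epsilon>"
    if pr: "a \<le> p" "r \<le> b" "r - p < \<delta>" "w p \<le> 0" "w r \<le> 0" and y: "y \<in> {p..r}" for p r y
  proof (cases "w y > 0")
    case True
    have "continuous_on {p..y} w" "continuous_on {y..r} w"
      using y pr by (auto intro: continuous_on_subset[OF w])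
    note wpy = this
    obtain c where c: "c \<in> {p..y}" "w c \<le> 0" "\<And>x. x \<in> {c<..y} \<Longrightarrow> w x > 0"
      by (rule last_nonpos[OF wpy(1), of p]) (use y pr in auto)
    obtain d where d: "d \<in> {y..r}" "w d \<le> 0" "\<And>x. x \<in> {y..<d} \<Longrightarrow> w x > 0"
      by (rule first_nonpos[OF wpy(2), of r]) (use y pr in auto)
    have cy: "c < y" "y < d" using c d True by (auto simp: less_le)
    have "continuous_on {c..y} w" "continuous_on {y..d} w"
      using c d y pr by (auto intro: continuous_on_subset[OF w])
    then have "w c = 0" "w d = 0"
      using zero_at_sign_change[of c y w c] zero_at_sign_change[of y d w d] c d cy by auto
    then have "\<Phi> c \<le> 0" "0 \<le> \<Phi> d"
      using up[of c y] down[of d y] c d cy y pr by auto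
    have "\<exists>x\<in>{c..d}. \<Phi> d - \<Phi> c = (d - c) *\<^sub>R \<Phi>' x"
    proof (rule mvt_very_simple[where f' = "\<lambda>x h. h *\<^sub>R \<Phi>' x"])
      show "(\<Phi> has_derivative (\<lambda>h. h *\<^sub>R \<Phi>' x)) (at x within {c..d})" if "c \<le> x" "x \<le> d" for x
        using has_vector_derivative_within_subset[OF \<Phi>, of x "{c..d}"] that c d y pr
        by (auto simp: has_vector_derivative_def)
    qed (use cy in auto)
    then obtain \<xi> where \<xi>: "\<xi> \<in> {c..d}" "\<Phi> d - \<Phi> c = (d - c) * \<Phi>' \<xi>" by auto
    then have "0 \<le> (d - c) * \<Phi>' \<xi>" using \<open>\<Phi> c \<le> 0\<close> \<open>0 \<le> \<Phi> d\<close> by linarith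
    then have "0 \<le> \<Phi>' \<xi>" using cy by (simp add: zero_le_mult_iff)
    moreover have "\<bar>\<Phi>' \<xi> - \<Phi>' y\<bar> < \<epsilon>"
      using \<xi> c d y pr by (intro \<delta>(2)) auto
    ultimately show ?thesis using pos[of y] True y pr by auto
  next
    case False
    then show ?thesis using nonpos[of y] y pr \<open>\<epsilon> > 0\<close> by auto
  qed
  have "P a b"
    using ab
  proof (induction rule: Bolzano)
    case (trans c d e)
    then show ?case
      using Henstock_Kurzweil_Integration.integral_combine[OF trans(3,4) int]
      by (auto simp: P_def algebra_simps)
  next
    case (local x)
    have "P c d" if cx: "c \<le> x" "x \<le> d" and cd: "d - c < \<delta>" for c d
      unfolding P_def
    proof
      assume ac: "a \<le> c \<and> d \<le> b"
      have wcd: "continuous_on {c..d} w" using ac by (intro continuous_on_subset[OF w]) auto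
      show "integral {c..d} D \<le> 2 * \<epsilon> * (d - c) + F c - F d"
      proof (cases "\<exists>y\<in>{c..d}. w y \<le> 0")
        case False
        then have "integral {c..d} D \<le> \<epsilon> * (d - c) + \<Phi> c - \<Phi> d"
          using ac cx by (intro drop) (auto simp: not_le)
        moreover have "\<epsilon> * (d - c) \<ge> 0" using \<open>\<epsilon> > 0\<close> cx by auto
        moreover have "F c = \<Phi> c" "F d = \<Phi> d" using False cx by (auto simp: F_def not_le)
        ultimately show ?thesis by simp
      next
        case True
        then obtain y where y: "y \<in> {c..d}" "w y \<le> 0" by auto
        \<comment> \<open>The interval is cut at its first and last nonpositive points. On the outer
          pieces \<open>w\<close> is positive away from the cut, and the sign of
          \<open>\<Phi>\<close> at the cut lets the inner boundary term be dropped. If an outer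
          piece is degenerate, \<open>F\<close> vanishes at that end of the interval.\<close>
        obtain p where p: "p \<in> {c..y}" "w p \<le> 0" "\<And>x. x \<in> {c..<p} \<Longrightarrow> w x > 0"
          using first_nonpos[OF wcd y] by metis
        obtain r where r: "r \<in> {y..d}" "w r \<le> 0" "\<And>x. x \<in> {r<..d} \<Longrightarrow> w x > 0"
          using last_nonpos[OF wcd y] by metis
        have "integral {c..p} D \<le> \<epsilon> * (p - c) + F c"
        proof (cases "p = c")
          case False
          then have "w p = 0" using zero_at_sign_change[OF wcd, of p] p y by auto
          then have "0 \<le> \<Phi> p" using down[of p c] p y ac False by auto
          moreover have "F c = \<Phi> c" using p False by (auto simp: F_def)
          moreover have "integral {c..p} D \<le> \<epsilon> * (p - c) + \<Phi> c - \<Phi> p"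
            using p y ac by (intro drop) auto
          ultimately show ?thesis by simp
        qed (use p in \<open>auto simp: F_def\<close>)
        moreover have "integral {r..d} D \<le> \<epsilon> * (d - r) - F d"
        proof (cases "r = d")
          case False
          then have "w r = 0" using zero_at_sign_change[OF wcd, of r] r y by auto
          then have "\<Phi> r \<le> 0" using up[of r d] r y ac False by auto
          moreover have "F d = \<Phi> d" using r False by (auto simp: F_def)
          moreover have "integral {r..d} D \<le> \<epsilon> * (d - r) + \<Phi> r - \<Phi> d"
            using r y ac by (intro drop) auto
          ultimately show ?thesis by simp
        qed (use r in \<open>auto simp: F_def\<close>)
        moreover have "integral {p..r} D \<le> 2 * \<epsilon> * (r - p)"
        proof -
          have "integral {p..r} D \<le> integral {p..r} (\<lambda>_. 2 * \<epsilon>)"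
            using p r y ac cd by (intro integral_le int between[of p r]) auto
          then show ?thesis using p r by (simp add: mult.commute mult.left_commute)
        qed
        moreover have "integral {c..d} D = integral {c..p} D + integral {p..r} D + integral {r..d} D"
          using Henstock_Kurzweil_Integration.integral_combine[of c p d D]
            Henstock_Kurzweil_Integration.integral_combine[of p r d D] p r y ac int by auto
        moreover have "\<epsilon> * (p - c) \<ge> 0" "\<epsilon> * (d - r) \<ge> 0" using \<open>\<epsilon> > 0\<close> p r by auto
        ultimately show ?thesis by (simp add: algebra_simps)
      qed
    qed
    then show ?case using \<delta>(1) by blast
  qed
  then show ?thesis by (simp add: P_def F_def)
qed

section \<open>Monotonicity from a one-sided derivative bound\<close>

text \<open>Fix \<open>c\<close> and a slope \<open>\<epsilon>\<close>. The first point
  \<open>p\<close> from which \<open>G\<close> grows by at most \<open>\<epsilon> * (c - p)\<close>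
  up to \<open>c\<close> must be \<open>a\<close>, since otherwise the Dini bound at
  \<open>p\<close> would give an earlier one. Then \<open>\<epsilon>\<close> tends to 0, and
  continuity adds the end points. Only interior times are used, because the equations may fail at a
  reset time.\<close>

lemma left_Dini_nonpos_imp_le:
  fixes G :: "real \<Rightarrow> real"
  assumes G: "continuous_on {a..b} G" and t: "t \<in> {a..b}"
    and dini: "\<And>c \<epsilon>. c \<in> {a<..<b} \<Longrightarrow> \<epsilon> > 0 \<Longrightarrow>
      \<exists>\<eta>>0. \<forall>h\<in>{0<..<\<eta>}. G c - G (c - h) \<le> \<epsilon> * h"
  shows "G t \<le> G a"
proof (cases "a < b")
  case True
  have le: "G c \<le> G a" if c: "c \<in> {a<..<b}" for c
  proof -
    have bound: "G c \<le> G a + \<epsilon> * (c - a)" if \<epsilon>: "\<epsilon> > 0" for \<epsilon>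
    proof -
      define H where "H x = G c - G x - \<epsilon> * (c - x)" for x
      have H: "continuous_on {a..c} H"
        unfolding H_def using c by (intro continuous_intros continuous_on_subset[OF G]) auto
      obtain p where p: "p \<in> {a..c}" "H p \<le> 0" "\<And>x. x \<in> {a..<p} \<Longrightarrow> H x > 0"
        using first_nonpos[OF H, of c] c by (auto simp: H_def)
      have "p = a"
      proof (rule ccontr)
        assume "p \<noteq> a"
        then obtain \<eta> where \<eta>: "\<eta> > 0" "\<And>h. h \<in> {0<..<\<eta>} \<Longrightarrow> G p - G (p - h) \<le> \<epsilon> * h"
          using dini[of p \<epsilon>] p(1) c \<epsilon> by auto
        define h where "h = min (\<eta> / 2) (p - a)"
        have h: "h \<in> {0<..<\<eta>}" "p - h \<in> {a..<p}"
          using \<eta>(1) p(1) \<open>p \<noteq> a\<close> by (auto simp: h_def min_def)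
        from p(3)[OF h(2)] p(2) \<eta>(2)[OF h(1)] show False
          by (simp add: H_def algebra_simps)
      qed
      then show ?thesis using p(2) by (simp add: H_def)
    qed
    show ?thesis
    proof (rule field_le_epsilon)
      fix e :: real assume "e > 0"
      then show "G c \<le> G a + e" using bound[of "e / (c - a)"] c by simp
    qed
  qed
  show ?thesis
    by (rule continuous_le_on_closure[of "{a<..<b}" G]) (use True G t le in auto)
next
  case False
  then have "t = a" using t by auto
  then show ?thesis by simp
qed

section \<open>Partial derivatives of twice differentiable functions\<close>

lemma C2_on_derivativeE:
  assumes "C2_on f S"
  obtains f' where "\<And>p. p \<in> S \<Longrightarrow> (f has_derivative blinfun_apply (f' p)) (at p within S)"
    "continuous_on S f'"
proof -
  obtain f' where f': "\<forall>p\<in>S. (f has_derivative blinfun_apply (f' p)) (at p within S)" "C1_on f' S"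
    using assms unfolding C2_on_def by (elim exE conjE) (rule that)
  obtain f'' where f'': "\<forall>p\<in>S. (f' has_derivative blinfun_apply (f'' p)) (at p within S)"
    using f'(2) unfolding C1_on_def by (elim exE conjE) (rule that)
  have "continuous_on S f'"
    by (rule has_derivative_continuous_on[OF bspec[OF f'']])
  with bspec[OF f'(1)] show ?thesis by (rule that)
qed

lemma C2_on_imp_continuous_on: "C2_on f S \<Longrightarrow> continuous_on S f"
  by (erule C2_on_derivativeE, erule has_derivative_continuous_on)

text \<open>By the chain rule the spatial derivative is the total derivative applied to
  \<open>(0, 1)\<close>, which gives its continuity. Positive length makes the one-sided derivatives
  at the two ends unique.\<close>

lemma C2_on_d_space:
  assumes u: "C2_on (\<lambda>(t, x). u t x) (J \<times> {0..L})" and t: "t \<in> J" and L: "0 < L"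
  shows "x \<in> {0..L} \<Longrightarrow> (u t has_vector_derivative d_space L u t x) (at x within {0..L})"
    and "continuous_on {0..L} (d_space L u t)"
proof -
  obtain f' where f': "\<And>p. p \<in> J \<times> {0..L} \<Longrightarrow>
      ((\<lambda>(t, x). u t x) has_derivative blinfun_apply (f' p)) (at p within J \<times> {0..L})"
    "continuous_on (J \<times> {0..L}) f'"
    by (rule C2_on_derivativeE[OF u], rule that)
  have d: "(u t has_vector_derivative f' (t, x) (0, 1)) (at x within {0..L})" if "x \<in> {0..L}" for x
  proof -
    have "((\<lambda>y. (t, y)) has_derivative (\<lambda>h. (0, h))) (at x within {0..L})"
      by (intro has_derivative_Pair has_derivative_const has_derivative_ident)
    from has_derivative_in_compose2[where f = "\<lambda>y. (t, y)", OF f'(1) _ that this]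
    have "((\<lambda>y. u t y) has_derivative (\<lambda>h. f' (t, x) (0, h))) (at x within {0..L})"
      using t by auto
    moreover have "(\<lambda>h. f' (t, x) (0, h)) = (\<lambda>h. h *\<^sub>R f' (t, x) (0, 1))"
      by (intro ext, subst blinfun.scaleR_right[symmetric]) simp
    ultimately show ?thesis by (simp only: has_vector_derivative_def)
  qed
  have eq: "d_space L u t x = f' (t, x) (0, 1)" if "x \<in> {0..L}" for x
    unfolding d_space_def using vector_derivative_within_closed_interval[OF L that d[OF that]] .
  show "(u t has_vector_derivative d_space L u t x) (at x within {0..L})" if "x \<in> {0..L}"
    using d[OF that] eq[OF that] by simp
  have "continuous_on {0..L} (\<lambda>x. f' (t, x))"
    by (rule continuous_on_compose2[OF f'(2)]) (use t in \<open>auto intro!: continuous_intros\<close>)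
  then have "continuous_on {0..L} (\<lambda>x. f' (t, x) (0, 1))"
    by (intro continuous_intros)
  then show "continuous_on {0..L} (d_space L u t)"
    by (rule continuous_on_eq) (simp add: eq)
qed

lemma C2_on_d_time:
  assumes u: "C2_on (\<lambda>(t, x). u t x) (J \<times> {0..L})" and J: "{a<..<b} \<subseteq> J"
  shows "t \<in> {a<..<b} \<Longrightarrow> x \<in> {0..L} \<Longrightarrow>
      ((\<lambda>s. u s x) has_vector_derivative d_time J u t x) (at t)"
    and "continuous_on ({a<..<b} \<times> {0..L}) (\<lambda>(t, x). d_time J u t x)"
proof -
  obtain f' where f': "\<And>p. p \<in> J \<times> {0..L} \<Longrightarrow>
      ((\<lambda>(t, x). u t x) has_derivative blinfun_apply (f' p)) (at p within J \<times> {0..L})"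
    "continuous_on (J \<times> {0..L}) f'"
    by (rule C2_on_derivativeE[OF u], rule that)
  \<comment> \<open>Inside the open interval the derivative no longer depends on \<open>J\<close>,
    so solutions whose equations hold on different time sets can be compared.\<close>
  have at: "at t within J = at t" if "t \<in> {a<..<b}" for t
    using that interior_mono[OF J] by (intro at_within_interior) auto
  have d: "((\<lambda>s. u s x) has_vector_derivative f' (t, x) (1, 0)) (at t)"
    if t: "t \<in> {a<..<b}" and x: "x \<in> {0..L}" for t x
  proof -
    have tJ: "t \<in> J" using t J by auto
    have "((\<lambda>s. (s, x)) has_derivative (\<lambda>h. (h, 0))) (at t within J)"
      by (intro has_derivative_Pair has_derivative_const has_derivative_ident)
    from has_derivative_in_compose2[where f = "\<lambda>s. (s, x)", OF f'(1) _ tJ this]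
    moreover have "(\<lambda>s. (s, x)) ` J \<subseteq> J \<times> {0..L}" using x by auto
    ultimately have "((\<lambda>s. u s x) has_derivative (\<lambda>h. f' (t, x) (h, 0))) (at t within J)"
      by simp
    moreover have "(\<lambda>h. f' (t, x) (h, 0)) = (\<lambda>h. h *\<^sub>R f' (t, x) (1, 0))"
      by (intro ext, subst blinfun.scaleR_right[symmetric]) simp
    ultimately show ?thesis by (simp only: has_vector_derivative_def at[OF t])
  qed
  have eq: "d_time J u t x = f' (t, x) (1, 0)" if "t \<in> {a<..<b}" "x \<in> {0..L}" for t x
    unfolding d_time_def at[OF that(1)] using vector_derivative_at[OF d[OF that]] .
  show "((\<lambda>s. u s x) has_vector_derivative d_time J u t x) (at t)"
    if "t \<in> {a<..<b}" "x \<in> {0..L}"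
    using d[OF that] eq[OF that] by simp
  have "continuous_on ({a<..<b} \<times> {0..L}) f'"
    by (rule continuous_on_subset[OF f'(2)]) (use J in auto)
  then have "continuous_on ({a<..<b} \<times> {0..L}) (\<lambda>p. f' p (1, 0))"
    by (intro continuous_intros)
  then show "continuous_on ({a<..<b} \<times> {0..L}) (\<lambda>(t, x). d_time J u t x)"
    by (rule continuous_on_eq) (auto simp: eq)
qed

section \<open>Decrease of the excess on one edge\<close>

text \<open>A negative derivative would make \<open>w\<close> drop just to the right of
  \<open>z\<close>. In the application \<open>S\<close> is the whole edge, so \<open>z\<close> may
  be one of its ends.\<close>

lemma right_deriv_nonneg:
  fixes w :: "real \<Rightarrow> real"
  assumes "(w has_real_derivative l) (at z within S)" "{z..y} \<subseteq> S" "z < y"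
    and "\<And>x. x \<in> {z<..y} \<Longrightarrow> w z \<le> w x"
  shows "0 \<le> l"
proof (rule ccontr)
  assume "\<not> 0 \<le> l"
  then obtain d where d: "d > 0" "\<And>h. h > 0 \<Longrightarrow> z + h \<in> S \<Longrightarrow> h < d \<Longrightarrow> w (z + h) < w z"
    using has_real_derivative_neg_dec_right[OF assms(1)] by auto
  define h where "h = min (d / 2) (y - z)"
  have h: "h > 0" "h < d" "z + h \<in> {z<..y}" using d(1) assms(3) by (auto simp: h_def min_def)
  then have "z + h \<in> S" using assms(2) by auto
  with d(2)[of h] h assms(4)[of "z + h"] show False by auto
qed

lemma left_deriv_nonpos:
  fixes w :: "real \<Rightarrow> real"
  assumes "(w has_real_derivative l) (at z within S)" "{y..z} \<subseteq> S" "y < z"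
    and "\<And>x. x \<in> {y..<z} \<Longrightarrow> w z \<le> w x"
  shows "l \<le> 0"
proof (rule ccontr)
  assume "\<not> l \<le> 0"
  then obtain d where d: "d > 0" "\<And>h. h > 0 \<Longrightarrow> z - h \<in> S \<Longrightarrow> h < d \<Longrightarrow> w (z - h) < w z"
    using has_real_derivative_pos_inc_left[OF assms(1)] by auto
  define h where "h = min (d / 2) (z - y)"
  have h: "h > 0" "h < d" "z - h \<in> {y..<z}" using d(1) assms(3) by (auto simp: h_def min_def)
  then have "z - h \<in> S" using assms(2) by auto
  with d(2)[of h] h assms(4)[of "z - h"] show False by auto
qed

text \<open>
  Convexity of the positive part gives \<open>max 0 w - max 0 w' \<le> w - w'\<close> where \<open>w > 0\<close> and
  \<open>\<le> 0\<close> elsewhere; taking \<open>w\<close> at time \<open>c\<close> and \<open>w'\<close> at the earlier time \<open>c - h\<close> makes the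
  set of positivity independent of \<open>h\<close>.
\<close>

lemma edge_excess_decrease:
  fixes u1 u2 p1 p2 :: "real \<Rightarrow> real \<Rightarrow> real"
  assumes L: "L > 0" and c: "c \<in> {a<..<b}" and \<epsilon>: "\<epsilon> > 0"
    and J: "{a<..<b} \<subseteq> J1" "{a<..<b} \<subseteq> J2"
    and C2: "C2_on (\<lambda>(t, x). u1 t x) (J1 \<times> {0..L})" "C2_on (\<lambda>(t, x). p1 t x) (J1 \<times> {0..L})"
      "C2_on (\<lambda>(t, x). u2 t x) (J2 \<times> {0..L})" "C2_on (\<lambda>(t, x). p2 t x) (J2 \<times> {0..L})"
    and conservation: "\<And>x. x \<in> {0..L} \<Longrightarrow> d_time J1 u1 c x + d_space L p1 c x = 0"
      "\<And>x. x \<in> {0..L} \<Longrightarrow> d_time J2 u2 c x + d_space L p2 c x = 0"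
    and dissipation: "\<And>x. x \<in> {0..L} \<Longrightarrow> p1 c x + f (u1 c x) (d_space L u1 c x) = 0"
      "\<And>x. x \<in> {0..L} \<Longrightarrow> p2 c x + f (u2 c x) (d_space L u2 c x) = 0"
    and mono: "\<And>x. x \<in> {0..L} \<Longrightarrow> strict_mono (f (u1 c x))"
  shows "\<exists>\<eta>>0. \<forall>h\<in>{0<..<\<eta>}.
    integral {0..L} (\<lambda>x. max 0 (u1 c x - u2 c x)) - integral {0..L} (\<lambda>x. max 0 (u1 (c - h) x - u2 (c - h) x))
      \<le> h * (2 * \<epsilon> * L + (if u1 c 0 > u2 c 0 then p1 c 0 - p2 c 0 else 0)
                    - (if u1 c L > u2 c L then p1 c L - p2 c L else 0))"
proof -
  define w where "w t x = u1 t x - u2 t x" for t x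
  define wt where "wt t x = d_time J1 u1 t x - d_time J2 u2 t x" for t x
  define wx where "wx x = d_space L u1 c x - d_space L u2 c x" for x
  define \<Phi> where "\<Phi> x = p1 c x - p2 c x" for x
  define \<Phi>' where "\<Phi>' x = d_space L p1 c x - d_space L p2 c x" for x
  have c': "c \<in> J1" "c \<in> J2" using c J by auto
  have w: "continuous_on {0..L} (w t)" if "t \<in> {a<..<b}" for t
  proof -
    have "t \<in> J1" "t \<in> J2" using that J by auto
    from continuous_on_vector_derivative[OF C2_on_d_space(1)[OF C2(1) this(1) L]]
      continuous_on_vector_derivative[OF C2_on_d_space(1)[OF C2(3) this(2) L]]
    show ?thesis unfolding w_def by (rule continuous_on_diff)
  qed
  have wx: "(w c has_real_derivative wx x) (at x within {0..L})" if "x \<in> {0..L}" for x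
    using has_vector_derivative_diff[OF C2_on_d_space(1)[OF C2(1) c'(1) L that]
        C2_on_d_space(1)[OF C2(3) c'(2) L that]]
    by (simp add: w_def[abs_def] wx_def has_real_derivative_iff_has_vector_derivative)
  have \<Phi>: "(\<Phi> has_vector_derivative \<Phi>' x) (at x within {0..L})" if "x \<in> {0..L}" for x
    using has_vector_derivative_diff[OF C2_on_d_space(1)[OF C2(2) c'(1) L that]
        C2_on_d_space(1)[OF C2(4) c'(2) L that]]
    by (simp add: \<Phi>_def[abs_def] \<Phi>'_def)
  have \<Phi>': "continuous_on {0..L} \<Phi>'"
    using continuous_on_diff[OF C2_on_d_space(2)[OF C2(2) c'(1) L] C2_on_d_space(2)[OF C2(4) c'(2) L]]
    by (simp add: \<Phi>'_def[abs_def])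
  have wt: "((\<lambda>s. w s x) has_vector_derivative wt t x) (at t)"
    if "t \<in> {a<..<b}" "x \<in> {0..L}" for t x
    using has_vector_derivative_diff[OF C2_on_d_time(1)[OF C2(1) J(1) that]
        C2_on_d_time(1)[OF C2(3) J(2) that]]
    by (simp add: w_def wt_def)
  have wt_cont: "continuous_on ({a<..<b} \<times> {0..L}) (\<lambda>(t, x). wt t x)"
    using continuous_on_diff[OF C2_on_d_time(2)[OF C2(1) J(1)] C2_on_d_time(2)[OF C2(3) J(2)]]
    by (simp add: wt_def case_prod_unfold)
  have wt_c: "wt c x = - \<Phi>' x" if "x \<in> {0..L}" for x
    using conservation[OF that] by (simp add: wt_def \<Phi>'_def)
  have mono': "f (u1 c x) v \<le> f (u1 c x) v'" if "x \<in> {0..L}" "v \<le> v'" for x v v'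
    using strict_mono_less_eq[OF mono[OF that(1)]] that(2) by simp
  \<comment> \<open>Where the densities agree, both dissipation terms have the same density
    argument, so the sign of \<open>\<Phi>\<close> is decided by the slopes alone.\<close>
  have flux: "\<Phi> x = f (u1 c x) (d_space L u2 c x) - f (u1 c x) (d_space L u1 c x)"
    if "x \<in> {0..L}" "w c x = 0" for x
    using dissipation[OF that(1)] that(2) by (simp add: w_def \<Phi>_def)
  \<comment> \<open>Going back only half way to \<open>a\<close> leaves a compact strip inside the
    open time interval. Uniform continuity of \<open>wt\<close> on it yields one step size for all
    positions \<open>x\<close>.\<close>
  define r where "r = (c - a) / 2"
  have r: "r > 0" "{c - r..c} \<subseteq> {a<..<b}" using c by (auto simp: r_def field_simps)
  have "{c - r..c} \<times> {0..L} \<subseteq> {a<..<b} \<times> {0..L}" using r by blast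
  then have "uniformly_continuous_on ({c - r..c} \<times> {0..L}) (\<lambda>(t, x). wt t x)"
    by (intro compact_uniformly_continuous compact_Times compact_Icc continuous_on_subset[OF wt_cont])
  then obtain \<delta> where \<delta>: "\<delta> > 0"
    "\<And>p p'. \<lbrakk>p \<in> {c - r..c} \<times> {0..L}; p' \<in> {c - r..c} \<times> {0..L}; dist p' p < \<delta>\<rbrakk> \<Longrightarrow>
      dist (case_prod wt p') (case_prod wt p) < \<epsilon>"
    using uniformly_continuous_onE[OF _ \<epsilon>] by blast
  have step: "w c x - w (c - h) x \<le> h * (\<epsilon> - \<Phi>' x)"
    if h: "0 < h" "h < r" "h < \<delta>" and x: "x \<in> {0..L}" for h x
  proof -
    have "\<exists>\<xi>\<in>{c - h..c}. w c x - w (c - h) x = (c - (c - h)) *\<^sub>R wt \<xi> x"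
    proof (rule mvt_very_simple[where f = "\<lambda>s. w s x" and f' = "\<lambda>\<xi> h. h *\<^sub>R wt \<xi> x"])
      show "((\<lambda>s. w s x) has_derivative (\<lambda>h. h *\<^sub>R wt \<xi> x)) (at \<xi> within {c - h..c})"
        if "c - h \<le> \<xi>" "\<xi> \<le> c" for \<xi>
      proof -
        have "\<xi> \<in> {c - r..c}" using that h by simp
        then have "\<xi> \<in> {a<..<b}" using r(2) by blast
        from has_vector_derivative_at_within[OF wt[OF this x]] show ?thesis
          by (simp add: has_vector_derivative_def)
      qed
    qed (use h in auto)
    then obtain \<xi> where \<xi>: "\<xi> \<in> {c - h..c}" "w c x - w (c - h) x = h * wt \<xi> x" by auto
    have "dist (\<xi>, x) (c, x) < \<delta>" using \<xi>(1) h by (simp add: dist_Pair_Pair dist_real_def)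
    with \<delta>(2)[of "(c, x)" "(\<xi>, x)"] have "dist (wt \<xi> x) (wt c x) < \<epsilon>"
      using \<xi>(1) h r x by auto
    then have "wt \<xi> x \<le> \<epsilon> - \<Phi>' x" using wt_c[OF x] by (simp add: dist_real_def)
    then show ?thesis using \<xi>(2) h by simp
  qed
  have "integral {0..L} (\<lambda>x. max 0 (w c x)) - integral {0..L} (\<lambda>x. max 0 (w (c - h) x))
      \<le> h * (2 * \<epsilon> * L + (if w c 0 > 0 then \<Phi> 0 else 0) - (if w c L > 0 then \<Phi> L else 0))"
    if h: "h \<in> {0<..<min r \<delta>}" for h
  proof -
    have h': "0 < h" "h < r" "h < \<delta>" using h by auto
    \<comment> \<open>With \<open>h\<close> fixed, this backward difference quotient is a continuous
      function of \<open>x\<close>, and the flux estimate applies to it with \<open>w\<close> and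
      \<open>\<Phi>\<close> taken at the single time \<open>c\<close>.\<close>
    define D where "D x = (max 0 (w c x) - max 0 (w (c - h) x)) / h" for x
    have "c - h \<in> {c - r..c}" using h' by simp
    then have ch: "c - h \<in> {a<..<b}" using r(2) by blast
    have cont: "continuous_on {0..L} (\<lambda>x. max 0 (w c x))"
      "continuous_on {0..L} (\<lambda>x. max 0 (w (c - h) x))"
      by (rule continuous_on_max[OF continuous_on_const w[OF c]]
          continuous_on_max[OF continuous_on_const w[OF ch]])+
    have "integral {0..L} D \<le> 2 * \<epsilon> * (L - 0) + (if w c 0 > 0 then \<Phi> 0 else 0)
        - (if w c L > 0 then \<Phi> L else 0)"
    proof (rule integral_le_boundary_flux[where \<Phi>' = \<Phi>'])
      show "continuous_on {0..L} D" unfolding D_def by (intro continuous_intros cont) (use h' in auto)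
      show "D x \<le> 0" if "x \<in> {0..L}" "w c x \<le> 0" for x
        using that h' by (auto simp: D_def divide_le_0_iff)
      show "D x \<le> \<epsilon> - \<Phi>' x" if "x \<in> {0..L}" "w c x > 0" for x
      proof -
        have "max 0 (w c x) - max 0 (w (c - h) x) \<le> h * (\<epsilon> - \<Phi>' x)"
          using step[OF h' that(1)] that(2) by auto
        then show ?thesis using h' by (simp add: D_def pos_divide_le_eq mult.commute)
      qed
      show "\<Phi> z \<le> 0" if z: "z \<in> {0..L}" "y \<in> {0..L}" "z < y" "w c z = 0" "\<forall>x\<in>{z<..y}. w c x > 0" for z y
      proof -
        have "0 \<le> wx z"
          by (rule right_deriv_nonneg[OF wx[OF z(1)], of y]) (use z in \<open>auto intro: less_imp_le\<close>)
        then show ?thesis using flux[of z] mono'[of z "d_space L u2 c z" "d_space L u1 c z"] z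
          by (simp add: wx_def)
      qed
      show "\<Phi> z \<ge> 0" if z: "z \<in> {0..L}" "y \<in> {0..L}" "y < z" "w c z = 0" "\<forall>x\<in>{y..<z}. w c x > 0" for z y
      proof -
        have "wx z \<le> 0"
          by (rule left_deriv_nonpos[OF wx[OF z(1)], of y]) (use z in \<open>auto intro: less_imp_le\<close>)
        then show ?thesis using flux[of z] mono'[of z "d_space L u1 c z" "d_space L u2 c z"] z
          by (simp add: wx_def)
      qed
    qed (use L \<epsilon> w[OF c] \<Phi> \<Phi>' in auto)
    moreover have "integral {0..L} D = (integral {0..L} (\<lambda>x. max 0 (w c x))
        - integral {0..L} (\<lambda>x. max 0 (w (c - h) x))) / h"
      unfolding D_def
      by (simp only: integral_divide
          integral_diff[OF integrable_continuous_real[OF cont(1)] integrable_continuous_real[OF cont(2)]])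
    ultimately show ?thesis using h' by (simp add: pos_divide_le_eq mult.commute)
  qed
  moreover have "min r \<delta> > 0" using r \<delta> by auto
  ultimately show ?thesis unfolding w_def \<Phi>_def diff_gt_0_iff_gt by blast
qed

section \<open>Comparison of two flows on the network\<close>

text \<open>Each edge gives its \<open>g\<close> term to its tail and its \<open>h\<close> term to
  its head. This regroups the fluxes at the ends of the edges by node, the form in which the vertex
  balance can be used.\<close>

lemma sum_edges_eq_sum_verts:
  fixes g h :: "'v \<Rightarrow> 'v \<Rightarrow> real"
  assumes "finite (verts N)" "edges N \<subseteq> verts N \<times> verts N"
  shows "(\<Sum>(i, j)\<in>edges N. g i j - h i j) =
    (\<Sum>j\<in>verts N. (\<Sum>k\<in>out_nbrs N j. g j k) - (\<Sum>i\<in>in_nbrs N j. h i j))"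
proof -
  have fin: "finite (out_nbrs N j)" "finite (in_nbrs N j)" for j
    using assms by (auto simp: out_nbrs_def in_nbrs_def intro!: finite_subset[OF _ assms(1)])
  have "(\<Sum>j\<in>verts N. \<Sum>k\<in>out_nbrs N j. g j k) = (\<Sum>(i, j)\<in>edges N. g i j)"
    by (subst sum.Sigma) (use assms fin in \<open>auto simp: out_nbrs_def intro!: sum.cong\<close>)
  moreover have "(\<Sum>j\<in>verts N. \<Sum>i\<in>in_nbrs N j. h i j) = (\<Sum>(i, j)\<in>edges N. h i j)"
    by (subst sum.Sigma)
      (use assms fin in \<open>auto simp: in_nbrs_def
        intro!: sum.reindex_bij_witness[of _ prod.swap prod.swap]\<close>)
  ultimately show ?thesis
    by (simp add: sum_subtractf case_prod_unfold)
qed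

lemma vertex_densityD:
  assumes "vertex_density N s t" "(i, j) \<in> edges N"
  shows "dens s i j t 0 = alpha_lo N i j t * nodal s i t"
    and "dens s i j t (len N i j) = alpha_hi N i j t * nodal s j t"
  using assms by (auto simp: vertex_density_def)

text \<open>At an isolated node the vertex conditions do not tie the nodal density to any edge
  density, so neither its continuity nor its order can be derived; such a node contributes no
  boundary flux.\<close>

definition meets_edge :: "'v network \<Rightarrow> 'v \<Rightarrow> bool" where
  "meets_edge N j \<longleftrightarrow> in_nbrs N j \<noteq> {} \<or> out_nbrs N j \<noteq> {}"

text \<open>The total excess \<open>W\<close> of \<open>s1\<close> over \<open>s2\<close> vanishes
  at \<open>a\<close> and has nonpositive left Dini derivative, hence stays zero. Here
  \<open>s1\<close> is the flow to be shown smaller, whichever scenario it comes from. Injections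
  need to be ordered only at nodes where \<open>s1\<close> is the larger one, because no other node
  contributes to the growth of \<open>W\<close>.\<close>

lemma comparison_on_interval:
  fixes N :: "'v network" and s1 s2 :: "'v state"
  assumes network: "flow_network N T" and ab: "{a..b} \<subseteq> {0..T}"
    and eqs: "satisfies_equations N J1 0 q1 s1" "satisfies_equations N J2 0 q2 s2"
    and J: "{a<..<b} \<subseteq> J1" "{a<..<b} \<subseteq> J2"
    and vertex: "\<And>t. t \<in> {a..b} \<Longrightarrow> vertex_density N s1 t" "\<And>t. t \<in> {a..b} \<Longrightarrow> vertex_density N s2 t"
    and cont: "\<And>i j. (i, j) \<in> edges N \<Longrightarrow> continuous_on ({a..b} \<times> {0..len N i j}) (\<lambda>(t, x). dens s1 i j t x)"
      "\<And>i j. (i, j) \<in> edges N \<Longrightarrow> continuous_on ({a..b} \<times> {0..len N i j}) (\<lambda>(t, x). dens s2 i j t x)"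
    and nonneg: "\<And>i j t x. \<lbrakk>(i, j) \<in> edges N; t \<in> {a..b}; x \<in> {0..len N i j}\<rbrakk> \<Longrightarrow> 0 \<le> dens s1 i j t x"
    and order: "\<And>j t. \<lbrakk>j \<in> verts N; meets_edge N j; t \<in> {a<..<b}; nodal s2 j t < nodal s1 j t\<rbrakk> \<Longrightarrow> q1 j t \<le> q2 j t"
    and init: "\<And>i j x. \<lbrakk>(i, j) \<in> edges N; x \<in> {0..len N i j}\<rbrakk> \<Longrightarrow> dens s1 i j a x \<le> dens s2 i j a x"
    and ij: "(i, j) \<in> edges N" and t: "t \<in> {a..b}" and x: "x \<in> {0..len N i j}"
  shows "dens s1 i j t x \<le> dens s2 i j t x"
proof -
  define E where "E = edges N"
  have V: "finite (verts N)" "edges N \<subseteq> verts N \<times> verts N"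
    and fin: "finite E"
    using network finite_subset unfolding flow_network_def E_def by (auto dest: finite_subset)
  have L: "len N i j > 0" if "(i, j) \<in> E" for i j
    using network that by (auto simp: flow_network_def E_def)
  define e where "e i j t = integral {0..len N i j} (\<lambda>x. max 0 (dens s1 i j t x - dens s2 i j t x))" for i j t
  define W where "W t = (\<Sum>(i, j)\<in>E. e i j t)" for t
  have excess: "continuous_on ({a..b} \<times> {0..len N i j}) (\<lambda>(t, x). max 0 (dens s1 i j t x - dens s2 i j t x))"
    if "(i, j) \<in> E" for i j
    using continuous_on_max[OF continuous_on_const continuous_on_diff[OF cont[of i j]], of 0] that
    by (simp add: E_def case_prod_unfold)
  have excess_t: "continuous_on {0..len N i j} (\<lambda>x. max 0 (dens s1 i j t x - dens s2 i j t x))"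
    if "(i, j) \<in> E" "t \<in> {a..b}" for i j t
  proof -
    have "continuous_on {0..len N i j} (Pair t)" by (intro continuous_intros)
    moreover have "Pair t ` {0..len N i j} \<subseteq> {a..b} \<times> {0..len N i j}" using that by auto
    ultimately show ?thesis using continuous_on_compose2[OF excess[OF that(1)]] by force
  qed
  have "continuous_on {a..b} (e i j)" if "(i, j) \<in> E" for i j
    using integral_continuous_on_param[of "{a..b}" 0 "len N i j"] excess[OF that]
    by (simp add: e_def[abs_def])
  then have W: "continuous_on {a..b} W"
    unfolding W_def by (auto intro!: continuous_on_sum)
  have "W t \<le> W a"
  proof (rule left_Dini_nonpos_imp_le[OF W t])
    fix c \<epsilon> :: real assume c: "c \<in> {a<..<b}" and \<epsilon>: "\<epsilon> > 0"
    define P where "P i j x = (if dens s1 i j c x > dens s2 i j c x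
      then flow s1 i j c x - flow s2 i j c x else 0)" for i j x
    \<comment> \<open>Adding 1 keeps \<open>\<Lambda>\<close> positive when there are no edges. With
      \<open>\<epsilon>'\<close> the errors of all edges together amount to at most
      \<open>\<epsilon>\<close> per unit of time.\<close>
    define \<Lambda> where "\<Lambda> = 1 + (\<Sum>(i, j)\<in>E. len N i j)"
    have \<Lambda>: "\<Lambda> > 0" unfolding \<Lambda>_def
      using sum_nonneg[of E "\<lambda>(i, j). len N i j"] L by (fastforce simp: less_imp_le)
    define \<epsilon>' where "\<epsilon>' = \<epsilon> / (2 * \<Lambda>)"
    have \<epsilon>': "\<epsilon>' > 0" using \<epsilon> \<Lambda> by (simp add: \<epsilon>'_def)
    have cJ: "c \<in> J1" "c \<in> J2" and cT: "c \<in> {0..T}" and cab: "c \<in> {a..b}"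
      using c J ab by auto
    have "\<exists>\<eta>>0. \<forall>h\<in>{0<..<\<eta>}. e i j c - e i j (c - h) \<le> h * (2 * \<epsilon>' * len N i j + P i j 0 - P i j (len N i j))"
      if ij: "(i, j) \<in> E" for i j
      unfolding e_def P_def
    proof (rule edge_excess_decrease[OF L[OF ij] c \<epsilon>' J, where f = "diss N i j c"])
      show "strict_mono (diss N i j c (dens s1 i j c x))" if "x \<in> {0..len N i j}" for x
        using network ij that cT nonneg[of i j c x] cab by (auto simp: flow_network_def E_def)
    qed (use eqs ij cJ in \<open>auto simp: satisfies_equations_def E_def\<close>)
    then have "\<forall>p\<in>E. \<exists>\<eta>>0. \<forall>h\<in>{0<..<\<eta>}. (case p of (i, j) \<Rightarrow>
        e i j c - e i j (c - h) \<le> h * (2 * \<epsilon>' * len N i j + P i j 0 - P i j (len N i j)))"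
      by auto
    then obtain \<eta> where \<eta>: "\<And>p. p \<in> E \<Longrightarrow> \<eta> p > 0"
      "\<And>i j h. (i, j) \<in> E \<Longrightarrow> h \<in> {0<..<\<eta> (i, j)} \<Longrightarrow>
        e i j c - e i j (c - h) \<le> h * (2 * \<epsilon>' * len N i j + P i j 0 - P i j (len N i j))"
      unfolding bchoice_iff by fastforce
    \<comment> \<open>The control factors are positive and common to both flows, so at every edge
      end meeting \<open>j\<close> the densities compare as the nodal densities do. The positivity
      condition thus becomes one factor per node and leaves the sums over its edges.\<close>
    define \<nu> where "\<nu> j = (if nodal s2 j c < nodal s1 j c then 1 else 0 :: real)" for j
    have P: "P i j 0 = \<nu> i * (flow s1 i j c 0 - flow s2 i j c 0)"
        "P i j (len N i j) = \<nu> j * (flow s1 i j c (len N i j) - flow s2 i j c (len N i j))"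
      if "(i, j) \<in> E" for i j
    proof -
      have "alpha_lo N i j c > 0" "alpha_hi N i j c > 0"
        using network that cT by (auto simp: flow_network_def E_def)
      then show "P i j 0 = \<nu> i * (flow s1 i j c 0 - flow s2 i j c 0)"
        "P i j (len N i j) = \<nu> j * (flow s1 i j c (len N i j) - flow s2 i j c (len N i j))"
        using vertex[OF cab, THEN vertex_densityD(1), of i j]
          vertex[OF cab, THEN vertex_densityD(2), of i j] that
        by (auto simp: P_def \<nu>_def E_def)
    qed
    have "(\<Sum>(i, j)\<in>E. P i j 0 - P i j (len N i j)) =
      (\<Sum>(i, j)\<in>E. \<nu> i * (flow s1 i j c 0 - flow s2 i j c 0)
        - \<nu> j * (flow s1 i j c (len N i j) - flow s2 i j c (len N i j)))"
      by (auto simp: P intro!: sum.cong)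
    also have "\<dots> = (\<Sum>j\<in>verts N. (\<Sum>k\<in>out_nbrs N j. \<nu> j * (flow s1 j k c 0 - flow s2 j k c 0))
        - (\<Sum>i\<in>in_nbrs N j. \<nu> j * (flow s1 i j c (len N i j) - flow s2 i j c (len N i j))))"
      unfolding E_def by (rule sum_edges_eq_sum_verts[OF V])
    also have "\<dots> \<le> 0"
    proof (rule sum_nonpos)
      fix j assume j: "j \<in> verts N"
      let ?S = "(\<Sum>k\<in>out_nbrs N j. \<nu> j * (flow s1 j k c 0 - flow s2 j k c 0))
        - (\<Sum>i\<in>in_nbrs N j. \<nu> j * (flow s1 i j c (len N i j) - flow s2 i j c (len N i j)))"
      have "vertex_balance N q1 s1 c" "vertex_balance N q2 s2 c"
        using eqs cJ by (auto simp: satisfies_equations_def)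
      then have "q1 j c + (\<Sum>i\<in>in_nbrs N j. flow s1 i j c (len N i j)) - (\<Sum>k\<in>out_nbrs N j. flow s1 j k c 0) = 0"
        "q2 j c + (\<Sum>i\<in>in_nbrs N j. flow s2 i j c (len N i j)) - (\<Sum>k\<in>out_nbrs N j. flow s2 j k c 0) = 0"
        using j unfolding vertex_balance_def by blast+
      then have "(\<Sum>k\<in>out_nbrs N j. flow s1 j k c 0) - (\<Sum>k\<in>out_nbrs N j. flow s2 j k c 0)
        - ((\<Sum>i\<in>in_nbrs N j. flow s1 i j c (len N i j)) - (\<Sum>i\<in>in_nbrs N j. flow s2 i j c (len N i j)))
        = q1 j c - q2 j c"
        by linarith
      then have S: "?S = \<nu> j * (q1 j c - q2 j c)"
        by (simp add: sum_distrib_left[symmetric] sum_subtractf right_diff_distrib[symmetric])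
      show "?S \<le> 0"
      proof (cases "meets_edge N j \<and> nodal s2 j c < nodal s1 j c")
        case True
        then have "q1 j c \<le> q2 j c" using order j c by auto
        then show ?thesis unfolding S by (simp add: \<nu>_def)
      next
        case False
        then show ?thesis by (auto simp: meets_edge_def \<nu>_def)
      qed
    qed
    finally have boundary: "(\<Sum>(i, j)\<in>E. P i j 0 - P i j (len N i j)) \<le> 0" .
    \<comment> \<open>The inserted 1 makes the minimum meaningful when there are no edges.\<close>
    define \<eta>0 where "\<eta>0 = Min (insert 1 (\<eta> ` E))"
    have "\<eta>0 > 0" unfolding \<eta>0_def using fin \<eta>(1) by simp
    moreover have "W c - W (c - h) \<le> \<epsilon> * h" if h: "h \<in> {0<..<\<eta>0}" for h
    proof -
      have "h < \<eta> (i, j)" if "(i, j) \<in> E" for i j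
        using h fin that unfolding \<eta>0_def by auto
      then have "e i j c - e i j (c - h) \<le> h * (2 * \<epsilon>' * len N i j + P i j 0 - P i j (len N i j))"
        if "(i, j) \<in> E" for i j
        using \<eta>(2)[OF that, of h] h that by simp
      then have "(\<Sum>(i, j)\<in>E. e i j c - e i j (c - h)) \<le>
        (\<Sum>(i, j)\<in>E. h * (2 * \<epsilon>' * len N i j + P i j 0 - P i j (len N i j)))"
        by (auto intro!: sum_mono)
      also have "\<dots> = h * (2 * \<epsilon>' * (\<Lambda> - 1) + (\<Sum>(i, j)\<in>E. P i j 0 - P i j (len N i j)))"
        by (simp add: \<Lambda>_def case_prod_unfold sum_distrib_left[symmetric] sum.distrib
            sum_subtractf add_diff_eq[symmetric])
      also have "\<dots> \<le> h * (2 * \<epsilon>' * \<Lambda>)"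
        using h boundary \<epsilon>' by (intro mult_left_mono) (auto simp: algebra_simps)
      also have "\<dots> = \<epsilon> * h" using \<Lambda> by (simp add: \<epsilon>'_def)
      finally show ?thesis by (simp add: W_def sum_subtractf case_prod_unfold)
    qed
    ultimately show "\<exists>\<eta>>0. \<forall>h\<in>{0<..<\<eta>}. W c - W (c - h) \<le> \<epsilon> * h" by blast
  qed
  also have "W a = 0"
  proof -
    have "e i j a = integral {0..len N i j} (\<lambda>_. 0)" if "(i, j) \<in> E" for i j
      unfolding e_def by (rule integral_cong) (use init[of i j] that in \<open>auto simp: E_def\<close>)
    then show ?thesis unfolding W_def by (intro sum.neutral) auto
  qed
  finally have "W t \<le> 0" .
  have e_nonneg: "0 \<le> e i j t" if "(i, j) \<in> E" for i j
    unfolding e_def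
    by (rule integral_nonneg[OF integrable_continuous_real[OF excess_t[OF that t]]]) simp
  then have "0 \<le> W t" unfolding W_def by (intro sum_nonneg) auto
  with \<open>W t \<le> 0\<close> have "W t = 0" by simp
  moreover have "W t = 0 \<longleftrightarrow> (\<forall>p\<in>E. (case p of (i, j) \<Rightarrow> e i j t) = 0)"
    unfolding W_def by (rule sum_nonneg_eq_0_iff[OF fin]) (auto simp: e_nonneg)
  ultimately have "e i j t = 0" using ij unfolding E_def by fastforce
  moreover have "e i j t = 0 \<longleftrightarrow> (\<forall>x\<in>{0..len N i j}. max 0 (dens s1 i j t x - dens s2 i j t x) = 0)"
    unfolding e_def
    by (rule integral_eq_0_iff) (use excess_t[of i j] L[of i j] ij t in \<open>auto simp: E_def\<close>)
  ultimately have "max 0 (dens s1 i j t x - dens s2 i j t x) = 0" using x by blast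
  then show ?thesis by simp
qed

section \<open>Order and continuity of nodal densities\<close>

lemma meets_edgeE:
  assumes "meets_edge N i"
  obtains (tail) j where "(i, j) \<in> edges N" | (head) j where "(j, i) \<in> edges N"
  using assms by (auto simp: meets_edge_def in_nbrs_def out_nbrs_def)

lemma flow_networkD:
  assumes "flow_network N T" "(i, j) \<in> edges N"
  shows "len N i j > 0" "t \<in> {0..T} \<Longrightarrow> alpha_lo N i j t > 0" "t \<in> {0..T} \<Longrightarrow> alpha_hi N i j t > 0"
  using assms by (auto simp: flow_network_def)

lemma nodal_le_if_dens_le:
  assumes N: "flow_network N T" "t \<in> {0..T}" "meets_edge N i"
    and vertex: "vertex_density N s t" "vertex_density N s' t"
    and le: "\<And>i j x. \<lbrakk>(i, j) \<in> edges N; x \<in> {0..len N i j}\<rbrakk> \<Longrightarrow> dens s i j t x \<le> dens s' i j t x"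
  shows "nodal s i t \<le> nodal s' i t"
  using N(3)
proof (cases rule: meets_edgeE)
  case (tail j)
  then show ?thesis
    using le[OF tail, of 0] vertex_densityD(1)[OF vertex(1) tail] vertex_densityD(1)[OF vertex(2) tail]
      flow_networkD[OF N(1) tail] N(2) by auto
next
  case (head j)
  then show ?thesis
    using le[OF head, of "len N j i"] vertex_densityD(2)[OF vertex(1) head]
      vertex_densityD(2)[OF vertex(2) head] flow_networkD[OF N(1) head] N(2) by auto
qed

text \<open>The nodal density is recovered from any one incident edge, as the density at its end
  divided by the positive control factor. \<open>I\<close> may be the whole horizon or the time
  between two resets.\<close>

lemma continuous_on_nodal:
  assumes N: "flow_network N T" "I \<subseteq> {0..T}" "meets_edge N i" and inputs: "smooth_inputs N 0 T q"
    and vertex: "\<And>t. t \<in> I \<Longrightarrow> vertex_density N s t"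
    and cont: "\<And>i j. (i, j) \<in> edges N \<Longrightarrow> continuous_on (I \<times> {0..len N i j}) (\<lambda>(t, x). dens s i j t x)"
  shows "continuous_on I (nodal s i)"
proof -
  have factor: "continuous_on I \<alpha>" if "C2_on (\<lambda>(t, r). \<alpha> t * r) ({0..T} \<times> {0..})" for \<alpha> :: "real \<Rightarrow> real"
  proof -
    \<comment> \<open>Smoothness is assumed for the compatibility function; its value at density 1
      is the control factor itself.\<close>
    have "(\<lambda>t. (t, 1)) ` I \<subseteq> {0..T} \<times> {0::real..}" using N(2) by auto
    then show ?thesis
      using continuous_on_compose2[OF C2_on_imp_continuous_on[OF that], of I "\<lambda>t. (t, 1)"]
      by (simp add: continuous_on_Pair)
  qed
  have dens: "continuous_on I (\<lambda>t. dens s i j t x)" if "(i, j) \<in> edges N" "x \<in> {0..len N i j}" for i j x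
  proof -
    have "(\<lambda>t. (t, x)) ` I \<subseteq> I \<times> {0..len N i j}" using that(2) by auto
    then show ?thesis
      using continuous_on_compose2[OF cont[OF that(1)], of I "\<lambda>t. (t, x)"]
      by (simp add: continuous_on_Pair)
  qed
  show ?thesis
    using N(3)
  proof (cases rule: meets_edgeE)
    case (tail j)
    have pos: "alpha_lo N i j t \<noteq> 0" if "t \<in> I" for t
      using flow_networkD(2)[OF N(1) tail, of t] that N(2) by auto
    have "continuous_on I (alpha_lo N i j)"
      by (rule factor) (use inputs tail in \<open>auto simp: smooth_inputs_def\<close>)
    moreover have "continuous_on I (\<lambda>t. dens s i j t 0)"
      using dens[OF tail] flow_networkD(1)[OF N(1) tail] by auto
    ultimately have "continuous_on I (\<lambda>t. dens s i j t 0 / alpha_lo N i j t)"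
      by (intro continuous_on_divide) (use pos in auto)
    then show ?thesis
      by (rule continuous_on_eq) (use pos vertex_densityD(1)[OF vertex tail] in auto)
  next
    case (head j)
    have pos: "alpha_hi N j i t \<noteq> 0" if "t \<in> I" for t
      using flow_networkD(3)[OF N(1) head, of t] that N(2) by auto
    have "continuous_on I (alpha_hi N j i)"
      by (rule factor) (use inputs head in \<open>auto simp: smooth_inputs_def\<close>)
    moreover have "continuous_on I (\<lambda>t. dens s j i t (len N j i))"
      using dens[OF head] flow_networkD(1)[OF N(1) head] by auto
    ultimately have "continuous_on I (\<lambda>t. dens s j i t (len N j i) / alpha_hi N j i t)"
      by (intro continuous_on_divide) (use pos in auto)
    then show ?thesis
      by (rule continuous_on_eq) (use pos vertex_densityD(2)[OF vertex head] in auto)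
  qed
qed

section \<open>Crossings and resets\<close>

text \<open>The last time before \<open>t\<close> at which \<open>g\<close> is not above
  \<open>h\<close> is a crossing: continuity gives equality there, and \<open>g\<close> lies
  strictly above \<open>h\<close> from then until \<open>t\<close>.\<close>

lemma crosses_above_before:
  assumes "continuous_on {0..T} g" "continuous_on {0..T} h" "g 0 \<le> h 0" "t \<in> {0..T}" "h t < g t"
  obtains c where "0 \<le> c" "c < t" "crosses_above g h T c"
proof -
  define w where "w x = g x - h x" for x
  have w: "continuous_on {0..t} w"
    unfolding w_def using assms
    by (intro continuous_on_diff) (auto elim: continuous_on_subset)
  obtain c where c: "c \<in> {0..t}" "w c \<le> 0" "\<And>x. x \<in> {c<..t} \<Longrightarrow> w x > 0"
    by (rule last_nonpos[OF w, of 0]) (use assms in \<open>auto simp: w_def\<close>)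
  have "c \<noteq> t" using c(2) assms(5) by (auto simp: w_def)
  then have ct: "c < t" using c(1) by simp
  have "w c = 0" using zero_at_sign_change[OF w c(1,2)] ct c(3) by auto
  moreover have "\<exists>x\<in>{0..T}. c < x \<and> x < c + \<delta> \<and> g x > h x" if "\<delta> > 0" for \<delta>
  proof
    have "w (min t (c + \<delta> / 2)) > 0" using ct that by (intro c(3)) auto
    then show "c < min t (c + \<delta> / 2) \<and> min t (c + \<delta> / 2) < c + \<delta> \<and>
        g (min t (c + \<delta> / 2)) > h (min t (c + \<delta> / 2))"
      using ct that by (auto simp: w_def)
    show "min t (c + \<delta> / 2) \<in> {0..T}" using ct c(1) that assms(4) by auto
  qed
  ultimately have "crosses_above g h T c" by (auto simp: crosses_above_def w_def)
  with that c(1) ct show ?thesis by auto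
qed

text \<open>A discrete intermediate value argument: \<open>\<tau>\<close> starts at or below
  \<open>c\<close> and is above it at \<open>Suc k\<close>, so some step passes from one side to the
  other.\<close>

lemma interval_containing:
  fixes \<tau> :: "nat \<Rightarrow> real"
  assumes "\<tau> 0 \<le> c" "c < \<tau> (Suc k)"
  obtains l where "l \<le> k" "c \<in> {\<tau> l..<\<tau> (Suc l)}"
  using assms by (induction k arbitrary: thesis) (force, metis atLeastLessThan_iff le_Suc_eq not_less)

text \<open>Every change of mode leads to \<open>Upper\<close> or \<open>Lower\<close>, never back
  to \<open>Nominal\<close>. A reset forced in an earlier interval thus still rules out the nominal
  injection later, although the node may meanwhile have switched between the two bounds.\<close>

lemma mode_persists:
  assumes policy: "monitoring_policy N T q q1 q2 s s1 s2 n \<tau> m"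
    and "k \<le> l" "l < n" "i \<in> verts N" "m k i \<noteq> Nominal"
  shows "m l i \<noteq> Nominal"
  using assms(2-3)
proof (induction l rule: dec_induct)
  case base
  show ?case by fact
next
  case (step l)
  have "m (Suc l) i \<noteq> m l i \<longrightarrow> m (Suc l) i = Upper \<or> m (Suc l) i = Lower"
    using policy step.prems assms(4) unfolding monitoring_policy_def by fastforce
  with step show ?case by auto
qed

context
  fixes N :: "'v network" and T q q1 q2 s s1 s2 n \<tau> m k i t
  assumes policy: "monitoring_policy N T q q1 q2 s s1 s2 n \<tau> m"
    and k: "k < n" and i: "i \<in> verts N" and t: "t \<in> {0..T}" "t \<le> \<tau> (Suc k)"
    and bounds: "q2 i t \<le> q1 i t"
    and cont: "continuous_on {0..T} (nodal s i)"
begin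

text \<open>Only a nominal injection above \<open>q1\<close> could fail. It would make
  \<open>i\<close> a monitored node, and the excess of its density over \<open>s1\<close> would stem
  from an earlier crossing, at which the policy requires the mode \<open>Upper\<close>; afterwards
  the mode cannot be nominal. In the other two modes the injection is one of the ordered
  bounds.\<close>

lemma applied_injection_le:
  assumes "continuous_on {0..T} (nodal s1 i)" "nodal s i 0 \<le> nodal s1 i 0" "nodal s1 i t < nodal s i t"
  shows "applied_injection q q1 q2 (m k) i t \<le> q1 i t"
proof (cases "m k i = Nominal \<and> \<not> q i t \<le> q1 i t")
  case True
  then have viol: "i \<in> upper_violations N T q q1"
    using i t by (auto simp: upper_violations_def)
  obtain c where c: "0 \<le> c" "c < t" "crosses_above (nodal s i) (nodal s1 i) T c"
    by (rule crosses_above_before[OF cont assms(1,2) t(1) assms(3)])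
  have "\<tau> 0 \<le> c" "c < \<tau> (Suc k)" using policy c t by (auto simp: monitoring_policy_def)
  then obtain l where l: "l \<le> k" "c \<in> {\<tau> l..<\<tau> (Suc l)}" by (rule interval_containing)
  then have "m l i = Upper"
    using policy k viol c(3) unfolding monitoring_policy_def by (meson le_less_trans)
  then show ?thesis using mode_persists[OF policy l(1) k i] True by auto
qed (use bounds in \<open>auto split: mode.split\<close>)

lemma applied_injection_ge:
  assumes "continuous_on {0..T} (nodal s2 i)" "nodal s2 i 0 \<le> nodal s i 0" "nodal s i t < nodal s2 i t"
  shows "q2 i t \<le> applied_injection q q1 q2 (m k) i t"
proof (cases "m k i = Nominal \<and> \<not> q2 i t \<le> q i t")
  case True
  then have viol: "i \<in> lower_violations N T q q2"
    using i t by (auto simp: lower_violations_def)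
  obtain c where c: "0 \<le> c" "c < t" "crosses_above (nodal s2 i) (nodal s i) T c"
    by (rule crosses_above_before[OF assms(1) cont assms(2) t(1) assms(3)])
  have "\<tau> 0 \<le> c" "c < \<tau> (Suc k)" using policy c t by (auto simp: monitoring_policy_def)
  then obtain l where l: "l \<le> k" "c \<in> {\<tau> l..<\<tau> (Suc l)}" by (rule interval_containing)
  then have "m l i = Lower"
    using policy k viol c(3) unfolding monitoring_policy_def by (meson le_less_trans)
  then show ?thesis using mode_persists[OF policy l(1) k i] True by auto
qed (use bounds in \<open>auto split: mode.split\<close>)

end

section \<open>The ordering through successive resets\<close>

lemma well_posedD:
  assumes "well_posed N a b J q s"
  shows "smooth_inputs N a b q" "satisfies_equations N J 0 q s"
    and "t \<in> {a..b} \<Longrightarrow> vertex_density N s t"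
    and "(i, j) \<in> edges N \<Longrightarrow> continuous_on ({a..b} \<times> {0..len N i j}) (\<lambda>(t, x). dens s i j t x)"
    and "\<lbrakk>(i, j) \<in> edges N; t \<in> {a..b}; x \<in> {0..len N i j}\<rbrakk> \<Longrightarrow> 0 \<le> dens s i j t x"
  using assms unfolding well_posed_def unique_solution_def ibvp_solution_def by auto

theorem corollary4:
  fixes N :: "'v network" and T \<rho>min \<rho>max :: real
    and q q1 q2 :: "'v \<Rightarrow> real \<Rightarrow> real"
    and s s1 s2 :: "'v state"
  assumes horizon: "T > 0"
    and network: "flow_network N T"
    and injection_bounds: "\<And>i t. i \<in> verts N \<Longrightarrow> t \<in> {0..T} \<Longrightarrow> q1 i t \<ge> q2 i t"
    and upper_scenario: "well_posed N 0 T {0..T} q1 s1"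
    and lower_scenario: "well_posed N 0 T {0..T} q2 s2"
    and feasible: "\<And>i j t x. (i, j) \<in> edges N \<Longrightarrow> t \<in> {0..T} \<Longrightarrow> x \<in> {0..len N i j} \<Longrightarrow>
        dens s1 i j t x \<in> {\<rho>min..\<rho>max} \<and> dens s2 i j t x \<in> {\<rho>min..\<rho>max}"
    and initial_order: "\<And>i j x. (i, j) \<in> edges N \<Longrightarrow> x \<in> {0..len N i j} \<Longrightarrow>
        dens s2 i j 0 x \<le> dens s i j 0 x \<and> dens s i j 0 x \<le> dens s1 i j 0 x"
    and policy: "monitored_flow N T q q1 q2 s s1 s2"
  shows "\<forall>(i, j)\<in>edges N. \<forall>t\<in>{0..T}. \<forall>x\<in>{0..len N i j}.
     dens s2 i j t x \<le> dens s i j t x \<and> dens s i j t x \<le> dens s1 i j t x"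
proof -
  obtain n \<tau> m where m: "monitoring_policy N T q q1 q2 s s1 s2 n \<tau> m"
    and wp: "\<forall>k<n. well_posed N (\<tau> k) (\<tau> (Suc k))
      (if k = 0 \<and> (\<forall>i\<in>verts N. m 0 i = Nominal) then {\<tau> k..\<tau> (Suc k)} else {\<tau> k<..\<tau> (Suc k)})
      (applied_injection q q1 q2 (m k)) s"
    using policy unfolding monitored_flow_def by blast
  define J where "J k = (if k = 0 \<and> (\<forall>i\<in>verts N. m 0 i = Nominal) then {\<tau> k..\<tau> (Suc k)}
    else {\<tau> k<..\<tau> (Suc k)})" for k
  have piece: "well_posed N (\<tau> k) (\<tau> (Suc k)) (J k) (applied_injection q q1 q2 (m k)) s" if "k < n" for k
    using wp that unfolding J_def by blast
  have J: "{\<tau> k<..<\<tau> (Suc k)} \<subseteq> J k" for k by (auto simp: J_def)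
  have \<tau>: "\<tau> 0 = 0" "\<tau> n = T" "\<And>k. k < n \<Longrightarrow> \<tau> k < \<tau> (Suc k)"
    using m by (auto simp: monitoring_policy_def)
  have mono: "\<tau> k \<le> \<tau> l" if "k \<le> l" "l \<le> n" for k l
    using that by (induction l rule: dec_induct) (force intro: order.trans less_imp_le[OF \<tau>(3)])+
  have range: "{\<tau> k..\<tau> (Suc k)} \<subseteq> {0..T}" if "k < n" for k
    using mono[of 0 k] mono[of "Suc k" n] that \<tau>(1,2) by auto
  have "n > 0" using \<tau>(1,2) horizon by (cases n) auto
  \<comment> \<open>The control factors belong to the network and are the same for all injections.
    Their regularity on the whole horizon, read off from the upper scenario, therefore serves both
    scenarios and the monitored flow.\<close>
  have cont1: "continuous_on {0..T} (nodal s1 i)" and cont2: "continuous_on {0..T} (nodal s2 i)"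
    if "meets_edge N i" for i
    by (rule continuous_on_nodal[OF network order.refl that well_posedD(1)[OF upper_scenario]];
        auto intro: well_posedD[OF upper_scenario] well_posedD[OF lower_scenario])+
  have cont: "continuous_on {0..T} (nodal s i)" if i: "meets_edge N i" for i
  proof -
    \<comment> \<open>A crossing may lie in an earlier interval than the time at which its effect is
      used, so continuity is glued across the resets to hold on all of
      \<open>{0..T}\<close>.\<close>
    have "continuous_on {0..\<tau> k} (nodal s i)" if "k \<le> n" for k
      using that
    proof (induction k)
      case 0
      then show ?case by (simp add: \<tau>(1))
    next
      case (Suc k)
      then have k: "k < n" by simp
      have "continuous_on {\<tau> k..\<tau> (Suc k)} (nodal s i)"
        by (rule continuous_on_nodal[OF network range[OF k] i well_posedD(1)[OF upper_scenario]])
          (auto intro: well_posedD[OF piece[OF k]])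
      moreover have "{0..\<tau> (Suc k)} = {0..\<tau> k} \<union> {\<tau> k..\<tau> (Suc k)}"
        using mono[of 0 k] \<tau>(1) \<tau>(3)[OF k] k by auto
      ultimately show ?case using Suc by (auto intro: continuous_on_closed_Un)
    qed
    from this[of n] show ?thesis by (simp add: \<tau>(2))
  qed
  have vertex0: "vertex_density N s 0" "vertex_density N s1 0" "vertex_density N s2 0"
    using well_posedD(3)[OF piece[OF \<open>n > 0\<close>], of 0] \<tau>(3)[OF \<open>n > 0\<close>] \<tau>(1)
      well_posedD(3)[OF upper_scenario, of 0] well_posedD(3)[OF lower_scenario, of 0] horizon by auto
  have nodal0: "nodal s2 i 0 \<le> nodal s i 0" "nodal s i 0 \<le> nodal s1 i 0" if "meets_edge N i" for i
    by (rule nodal_le_if_dens_le[OF network _ that]; use vertex0 initial_order horizon in auto)+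
  \<comment> \<open>Induction over the resets: the order reached at \<open>\<tau> k\<close> is the
    initial order for the comparison on the next interval. The order of the injections there comes
    instead from the crossing argument, which looks back to time 0.\<close>
  have "dens s2 i j t x \<le> dens s i j t x \<and> dens s i j t x \<le> dens s1 i j t x"
    if "k \<le> n" "(i, j) \<in> edges N" "t \<in> {0..\<tau> k}" "x \<in> {0..len N i j}" for k i j t x
    using that
  proof (induction k arbitrary: i j t x)
    case 0
    then show ?case using initial_order \<tau>(1) by auto
  next
    case (Suc k)
    then have k: "k < n" by simp
    have 0: "0 \<le> \<tau> k" using mono[of 0 k] \<tau>(1) k by simp
    show ?case
    proof (cases "t \<le> \<tau> k")
      case True
      with Suc show ?thesis by auto
    next
      case False
      then have t: "t \<in> {\<tau> k..\<tau> (Suc k)}" using Suc.prems by auto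
      note sub = range[OF k]
      have init: "dens s2 i j (\<tau> k) x \<le> dens s i j (\<tau> k) x \<and> dens s i j (\<tau> k) x \<le> dens s1 i j (\<tau> k) x"
        if "(i, j) \<in> edges N" "x \<in> {0..len N i j}" for i j x
        using Suc.IH[of i j "\<tau> k" x] k 0 that by auto
      have JT: "{\<tau> k<..<\<tau> (Suc k)} \<subseteq> {0..T}" using sub by force
      have contT: "continuous_on ({\<tau> k..\<tau> (Suc k)} \<times> {0..len N i j}) (\<lambda>(t, x). dens s' i j t x)"
        if "(i, j) \<in> edges N" "s' = s1 \<or> s' = s2" for i j s'
        using well_posedD(4)[OF upper_scenario that(1)] well_posedD(4)[OF lower_scenario that(1)] that(2) sub
        by (elim disjE) (auto elim!: continuous_on_subset)
      have "dens s i j t x \<le> dens s1 i j t x"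
      proof (rule comparison_on_interval[OF network sub well_posedD(2)[OF piece[OF k]]
            well_posedD(2)[OF upper_scenario] J JT])
        show "applied_injection q q1 q2 (m k) j t \<le> q1 j t"
          if "j \<in> verts N" "meets_edge N j" "t \<in> {\<tau> k<..<\<tau> (Suc k)}" "nodal s1 j t < nodal s j t" for j t
          using applied_injection_le[OF m k that(1) _ _ injection_bounds[OF that(1)] cont[OF that(2)]
              cont1[OF that(2)] nodal0(2)[OF that(2)] that(4)] that(3) JT by auto
      qed (use Suc.prems t sub init contT in
          \<open>auto intro: well_posedD[OF piece[OF k]] well_posedD[OF upper_scenario]\<close>)
      moreover have "dens s2 i j t x \<le> dens s i j t x"
      proof (rule comparison_on_interval[OF network sub well_posedD(2)[OF lower_scenario]
            well_posedD(2)[OF piece[OF k]] JT J])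
        show "q2 j t \<le> applied_injection q q1 q2 (m k) j t"
          if "j \<in> verts N" "meets_edge N j" "t \<in> {\<tau> k<..<\<tau> (Suc k)}" "nodal s j t < nodal s2 j t" for j t
          using applied_injection_ge[OF m k that(1) _ _ injection_bounds[OF that(1)] cont[OF that(2)]
              cont2[OF that(2)] nodal0(1)[OF that(2)] that(4)] that(3) JT by auto
      qed (use Suc.prems t sub init contT in
          \<open>auto intro: well_posedD[OF piece[OF k]] well_posedD[OF lower_scenario]\<close>)
      ultimately show ?thesis by blast
    qed
  qed
  from this[of n] show ?thesis by (auto simp: \<tau>(2))
qed

end
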